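(* Let $(\mathcal{X},d)$ be a complete separable metric space and $\lambda>0$. Assume that $X_1,\dots,X_n$ are $\mathcal{X}$-valued random variables generated according to the $O\cup I$ setting, and let $\mu$ denote the common distribution of the inliers. Let $\hat\mu_n^{(I)}=|I|^{-1}\sum_{i\in I}\delta_{X_i}$ be the empirical distribution based on the inliers and $\hat\mu_n=n^{-1}\sum_{i=1}^n\delta_{X_i}$ the empirical distribution of all the data. Set $$\sigma^2=|I|^{-1}\sum_{i\in I}\mathrm{E}\left[\min\left(d^2(X_i,X_i'),(2\lambda)^2\right)\right],$$ where $X_i'$ is an independent copy of $X_i$. Then: (i) when $O=\varnothing$, for any $t>0$, $$\mathbb{P}\left(\left|W^{(\lambda)}(\mu,\hat\mu_n^{(I)})-\mathrm{E}[W^{(\lambda)}(\mu,\hat\mu_n^{(I)})]\right|>\sigma\sqrt{\frac{2t}{|I|}}+\frac{4\lambda t}{|I|}\right)\le 2\exp(-t);$$ (ii) when $O\ne\varnothing$, for any $t>0$, $$\mathbb{P}\left(\left|W^{(\lambda)}(\mu,\hat\mu_n)-\frac{|I|}{n}\mathrm{E}[W^{(\lambda)}(\mu,\hat\mu_n^{(I)})]\right|>\sigma\sqrt{\frac{|I|}{n}}\sqrt{\frac{2t}{n}}+\frac{4\lambda t}{n}+\frac{2\lambda|O|}{n}\right)\le 2\exp(-t).$$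
   Context: $O\cup I$ setting: the index set $\{1,\dots,n\}$ is the disjoint union of $I$ (nonempty, inliers) and $O$ (outliers); the inliers $(X_i)_{i\in I}$ are i.i.d. with distribution $\mu$, while no assumption is made on the outliers $(X_i)_{i\in O}$. $\Pi(\mu,\nu)$ is the set of couplings of $\mu$ and $\nu$. The robust Wasserstein distance between Borel probability measures on $\mathcal{X}$ is $W^{(\lambda)}(\mu,\nu)=\inf_{\pi\in\Pi(\mu,\nu)}\int\min\{d(x,y),2\lambda\}\,d\pi(x,y)$. *)

theory Defs
  imports "HOL-Probability.Probability"
begin

definition couplings ::
  "'a::topological_space measure \<Rightarrow> 'a measure \<Rightarrow> ('a \<times> 'a) measure set" where
  "couplings \<mu> \<nu> =
     {\<pi>. prob_space \<pi> \<and> sets \<pi> = sets (borel \<Otimes>\<^sub>M borel) \<and>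
          distr \<pi> borel fst = \<mu> \<and> distr \<pi> borel snd = \<nu>}"

definition robust_wasserstein ::
  "real \<Rightarrow> 'a::metric_space measure \<Rightarrow> 'a measure \<Rightarrow> real" where
  "robust_wasserstein lam \<mu> \<nu> =
     (INF \<pi>\<in>couplings \<mu> \<nu>. LINT p|\<pi>. min (dist (fst p) (snd p)) (2 * lam))"

definition empirical_measure ::
  "'i set \<Rightarrow> ('i \<Rightarrow> 'a::topological_space) \<Rightarrow> 'a measure" where
  "empirical_measure J x =
     measure_of UNIV (sets borel)
       (\<lambda>A. (\<Sum>i\<in>J. emeasure (return borel (x i)) A) / of_nat (card J))"

(* measure_of yields the null measure when its argument is not countably additive;
   the next lemma shows that this does not happen here. *)
lemma emeasure_empirical_measure:
  fixes x :: "'i \<Rightarrow> 'a::topological_space"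
  assumes "A \<in> sets borel"
  shows "emeasure (empirical_measure J x) A =
    (\<Sum>i\<in>J. emeasure (return borel (x i)) A) / of_nat (card J)"
proof (rule emeasure_measure_of[OF empirical_measure_def])
  show "sets (borel :: 'a measure) \<subseteq> Pow UNIV" by simp
  show "A \<in> sets (empirical_measure J x)"
    using assms by (simp add: empirical_measure_def)
  show "positive (sets (empirical_measure J x))
     (\<lambda>A. (\<Sum>i\<in>J. emeasure (return borel (x i)) A) / of_nat (card J))"
    by (simp add: positive_def)
  show "countably_additive (sets (empirical_measure J x))
     (\<lambda>A. (\<Sum>i\<in>J. emeasure (return borel (x i)) A) / of_nat (card J))"
  proof (rule countably_additiveI)
    fix B :: "nat \<Rightarrow> 'a set"
    assume B: "range B \<subseteq> sets (empirical_measure J x)" "disjoint_family B"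
    then have "range B \<subseteq> sets borel"
      by (simp add: empirical_measure_def sets.sigma_sets_eq[of borel, simplified])
    then have *: "(\<Sum>k. emeasure (return borel (x i)) (B k)) =
        emeasure (return borel (x i)) (\<Union>k. B k)" for i
      using B(2) by (intro suminf_emeasure) auto
    show "(\<Sum>k. (\<Sum>i\<in>J. emeasure (return borel (x i)) (B k)) / of_nat (card J)) =
      (\<Sum>i\<in>J. emeasure (return borel (x i)) (\<Union>k. B k)) / of_nat (card J)"
      by (simp add: divide_ennreal_def suminf_sum * del: emeasure_return)
  qed
qed

(* M \<Otimes> M carries the independent copy: X_i(\<omega>) = X i (fst p), X_i'(\<omega>) = X i (snd p). *)
definition mean_truncated_sq_dist ::
  "'w measure \<Rightarrow> real \<Rightarrow> 'i set \<Rightarrow> ('i \<Rightarrow> 'w \<Rightarrow> 'a::metric_space) \<Rightarrow> real" where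
  "mean_truncated_sq_dist M lam J X =
     (\<Sum>i\<in>J. \<integral>p.
        min ((dist (X i (fst p)) (X i (snd p)))\<^sup>2) ((2 * lam)\<^sup>2)
          \<partial>(M \<Otimes>\<^sub>M M)) / real (card J)"

locale outlier_inlier_setting = prob_space M
  for M :: "'w measure" +
  fixes n :: nat and In Out :: "nat set"
    and X :: "nat \<Rightarrow> 'w \<Rightarrow> 'a::polish_space" and \<mu> :: "'a measure"
  assumes index_partition: "In \<union> Out = {1..n}" "In \<inter> Out = {}"
    and inliers_nonempty: "In \<noteq> {}"
    and random_variables: "\<And>i. i \<in> {1..n} \<Longrightarrow> random_variable borel (X i)"
    and inliers_indep: "indep_vars (\<lambda>_. borel) X In"
    and inliers_distr: "\<And>i. i \<in> In \<Longrightarrow> distr M borel (X i) = \<mu>"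

end

theory Submission
  imports Defs
begin

text \<open>
  Write \<open>k\<close> for the number of inliers and \<open>c(a, b) = min (dist a b) (2 * lam)\<close> for the transport
  cost.  As a function of the inliers, the distance from \<open>\<mu>\<close> to their empirical measure changes
  by at most \<open>c(a, b) / k\<close> when one point is moved from \<open>a\<close> to \<open>b\<close>
  (\<open>robust_wasserstein_empirical_lipschitz\<close>).  The inliers being independent, part (i) is then a
  Bernstein-type bounded difference inequality (\<open>bounded_differences_concentration\<close>): the
  difference bound depends on the moved coordinate only, through the random cost \<open>c\<close>, so the
  moment generating function of the deviation factorizes over the coordinates, each factor being
  controlled by the mean of \<open>c\<^sup>2\<close> with respect to two independent copies.  This puts \<open>\<sigma>\<close> in the
  square root term, whereas the uniform bound \<open>2 * lam\<close> enters the linear term only.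

  For part (ii), \<open>robust_wasserstein_empirical_outliers\<close> shows that, whatever the outliers are,
  the distance for the whole sample differs from \<open>k / n\<close> times the distance for the inliers by at
  most \<open>2 * lam\<close> times the proportion of outliers.  The claim is therefore the concentration
  inequality for the inliers, scaled by \<open>k / n\<close>.

  Both facts about the distance come from one construction,
  \<open>robust_wasserstein_empirical_transfer\<close>: a coupling of \<open>\<mu>\<close> with one empirical measure is
  turned into a coupling with another by redistributing the mass of every sample point according
  to a finite Markov matrix.
\<close>

section \<open>A Bernstein inequality for functions with bounded differences\<close>

lemma exp_le_one_plus_square:
  fixes z :: real
  assumes "\<bar>z\<bar> \<le> 1"
  shows "exp z \<le> 1 + z + z\<^sup>2"
proof (cases "z \<ge> 0")
  case True
  then show ?thesis using assms by (intro exp_bound) auto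
next
  case False
  obtain u where "exp z = (\<Sum>m<3. z ^ m / fact m) + exp u / fact 3 * z ^ 3"
    using Maclaurin_exp_le[of z 3] by auto
  moreover have "exp u / fact 3 * z ^ 3 \<le> 0"
    using False by (intro mult_nonneg_nonpos) (auto simp: power3_eq_cube mult_nonneg_nonpos)
  ultimately have "exp z \<le> 1 + z + z\<^sup>2 / 2"
    by (simp add: eval_nat_numeral)
  then show ?thesis
    using zero_le_power2[of z] by linarith
qed

lemma (in prob_space) integral_centered_square_eq:
  fixes g :: "'a \<Rightarrow> real"
  assumes g [measurable]: "g \<in> borel_measurable M"
    and bd: "\<And>a. a \<in> space M \<Longrightarrow> \<bar>g a\<bar> \<le> K"
  shows "2 * (\<integral>a. (g a - (\<integral>b. g b \<partial>M))\<^sup>2 \<partial>M) = (\<integral>p. (g (fst p) - g (snd p))\<^sup>2 \<partial>(M \<Otimes>\<^sub>M M))"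
proof -
  interpret P: pair_prob_space M M ..
  have sq: "(g a)\<^sup>2 \<le> K\<^sup>2" if "a \<in> space M" for a
    using bd[OF that] by (simp add: power2_le_iff_abs_le)
  have K: "K \<ge> 0"
    using bd not_empty by fastforce
  have i1 [simp]: "integrable M g"
    by (rule integrable_const_bound[of _ K]) (use bd in auto)
  have i2 [simp]: "integrable M (\<lambda>a. (g a)\<^sup>2)"
    by (rule integrable_const_bound[of _ "K\<^sup>2"]) (use sq in auto)
  have ip: "integrable (M \<Otimes>\<^sub>M M) (\<lambda>p. (g (fst p) - g (snd p))\<^sup>2)"
  proof (rule P.integrable_const_bound[of _ "(2 * K)\<^sup>2"])
    show "AE p in M \<Otimes>\<^sub>M M. norm ((g (fst p) - g (snd p))\<^sup>2) \<le> (2 * K)\<^sup>2"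
    proof (rule AE_I2)
      fix p assume "p \<in> space (M \<Otimes>\<^sub>M M)"
      then have "\<bar>g (fst p)\<bar> \<le> K" "\<bar>g (snd p)\<bar> \<le> K"
        using bd by (auto simp: space_pair_measure)
      then have "\<bar>g (fst p) - g (snd p)\<bar> \<le> 2 * K" by linarith
      from power_mono[OF this, of 2] show "norm ((g (fst p) - g (snd p))\<^sup>2) \<le> (2 * K)\<^sup>2"
        by (simp only: power2_abs real_norm_def abs_power2)
    qed
  qed auto
  have "(\<integral>p. (g (fst p) - g (snd p))\<^sup>2 \<partial>(M \<Otimes>\<^sub>M M)) = (\<integral>a. (\<integral>b. (g a - g b)\<^sup>2 \<partial>M) \<partial>M)"
    using P.integral_fst'[of "\<lambda>p. (g (fst p) - g (snd p))\<^sup>2"] ip by simp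
  also have "\<dots> = (\<integral>a. (g a)\<^sup>2 + (\<integral>b. (g b)\<^sup>2 \<partial>M) - 2 * g a * (\<integral>b. g b \<partial>M) \<partial>M)"
    by (simp add: power2_diff prob_space)
  also have "\<dots> = 2 * (\<integral>b. (g b)\<^sup>2 \<partial>M) - 2 * (\<integral>b. g b \<partial>M)\<^sup>2"
    by (subst Bochner_Integration.integral_diff Bochner_Integration.integral_add,
        use i1 i2 in \<open>auto simp: prob_space power2_eq_square[of "expectation g"]\<close>)+
  also have "\<dots> = 2 * (\<integral>a. (g a - (\<integral>b. g b \<partial>M))\<^sup>2 \<partial>M)"
    by (simp add: power2_diff prob_space) (simp add: power2_eq_square)
  finally show ?thesis ..
qed

text \<open>
  Since \<open>g\<close> stays within \<open>B\<close> of its mean, \<open>exp z \<le> 1 + z + z\<^sup>2\<close> may be integrated with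
  \<open>z\<close> the scaled centred value: the linear term vanishes, and the quadratic term is the
  variance.  Writing the variance with an independent copy, as half the mean square of
  \<open>g a - g b\<close>, is what brings in \<open>c\<close>; the factor one half absorbs the missing one half in the
  quadratic term of the exponential bound.
\<close>

lemma (in prob_space) mgf_le_of_oscillation:
  fixes g :: "'a \<Rightarrow> real" and c :: "'a \<Rightarrow> 'a \<Rightarrow> real"
  assumes g [measurable]: "g \<in> borel_measurable M"
    and c [measurable]: "(\<lambda>p. c (fst p) (snd p)) \<in> borel_measurable (M \<Otimes>\<^sub>M M)"
    and bd: "\<And>a. a \<in> space M \<Longrightarrow> \<bar>g a\<bar> \<le> K"
    and osc: "\<And>a b. a \<in> space M \<Longrightarrow> b \<in> space M \<Longrightarrow> \<bar>g a - g b\<bar> \<le> c a b"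
    and cB: "\<And>a b. a \<in> space M \<Longrightarrow> b \<in> space M \<Longrightarrow> c a b \<le> B"
    and s: "0 \<le> s" "s * B \<le> 1"
  shows "(\<integral>a. exp (s * (g a - (\<integral>b. g b \<partial>M))) \<partial>M)
           \<le> exp (s\<^sup>2 / 2 * (\<integral>p. (c (fst p) (snd p))\<^sup>2 \<partial>(M \<Otimes>\<^sub>M M)))"
proof -
  interpret P: pair_prob_space M M ..
  define m where "m = (\<integral>b. g b \<partial>M)"
  define V where "V = (\<integral>p. (c (fst p) (snd p))\<^sup>2 \<partial>(M \<Otimes>\<^sub>M M))"
  have i1 [simp]: "integrable M g"
    by (rule integrable_const_bound[of _ K]) (use bd in auto)
  have dev: "\<bar>g a - m\<bar> \<le> B" if a: "a \<in> space M" for a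
  proof -
    have "g a - m = (\<integral>b. g a - g b \<partial>M)"
      by (simp add: m_def prob_space)
    also have "\<bar>\<dots>\<bar> \<le> (\<integral>b. \<bar>g a - g b\<bar> \<partial>M)"
      using integral_norm_bound[of M "\<lambda>b. g a - g b"] by simp
    also have "\<dots> \<le> (\<integral>b. B \<partial>M)"
      by (intro integral_mono) (use a order_trans[OF osc cB] in auto)
    finally show ?thesis by (simp add: prob_space)
  qed
  have z: "\<bar>s * (g a - m)\<bar> \<le> 1" if "a \<in> space M" for a
    using mult_left_mono[OF dev[OF that] s(1)] s by (simp add: abs_mult)
  have i2: "integrable M (\<lambda>a. (g a - m)\<^sup>2)"
  proof (rule integrable_const_bound[of _ "B\<^sup>2"])
    show "AE a in M. norm ((g a - m)\<^sup>2) \<le> B\<^sup>2"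
      using dev by (auto intro!: AE_I2 simp: power2_le_iff_abs_le[OF order_trans[OF abs_ge_zero dev]])
  qed auto
  have i3: "integrable M (\<lambda>a. exp (s * (g a - m)))"
  proof (rule integrable_const_bound[of _ "exp 1"])
    show "AE a in M. norm (exp (s * (g a - m))) \<le> exp 1"
      using z by (auto intro!: AE_I2 dest: abs_le_D1)
  qed auto
  have ic: "integrable (M \<Otimes>\<^sub>M M) (\<lambda>p. (c (fst p) (snd p))\<^sup>2)"
  proof (rule P.integrable_const_bound[of _ "B\<^sup>2"])
    have "\<bar>c (fst p) (snd p)\<bar> \<le> B" if "p \<in> space (M \<Otimes>\<^sub>M M)" for p
      using that osc[of "fst p" "snd p"] cB[of "fst p" "snd p"]
      by (auto simp: space_pair_measure)
    then show "AE p in M \<Otimes>\<^sub>M M. norm ((c (fst p) (snd p))\<^sup>2) \<le> B\<^sup>2"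
      by (auto intro!: AE_I2) (metis abs_le_square_iff abs_ge_zero abs_of_nonneg order_trans)
  qed auto
  have "2 * (\<integral>a. (g a - m)\<^sup>2 \<partial>M) = (\<integral>p. (g (fst p) - g (snd p))\<^sup>2 \<partial>(M \<Otimes>\<^sub>M M))"
    unfolding m_def by (rule integral_centered_square_eq[OF g bd])
  also have "\<dots> \<le> V"
    unfolding V_def
  proof (rule integral_mono'[OF ic])
    fix p assume "p \<in> space (M \<Otimes>\<^sub>M M)"
    then show "(g (fst p) - g (snd p))\<^sup>2 \<le> (c (fst p) (snd p))\<^sup>2"
      using osc[of "fst p" "snd p"]
      by (auto simp: space_pair_measure abs_le_square_iff[symmetric])
  qed auto
  finally have var: "(\<integral>a. (g a - m)\<^sup>2 \<partial>M) \<le> V / 2" by simp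
  have "(\<integral>a. exp (s * (g a - m)) \<partial>M)
      \<le> (\<integral>a. 1 + s * (g a - m) + s\<^sup>2 * (g a - m)\<^sup>2 \<partial>M)"
    by (intro integral_mono i3)
       (use i2 exp_le_one_plus_square[OF z] in \<open>auto simp: power_mult_distrib\<close>)
  also have "\<dots> = 1 + s\<^sup>2 * (\<integral>a. (g a - m)\<^sup>2 \<partial>M)"
    using i2 by (simp add: prob_space m_def)
  also have "\<dots> \<le> 1 + s\<^sup>2 * (V / 2)"
    using var by (intro add_left_mono mult_left_mono) auto
  also have "\<dots> \<le> exp (s\<^sup>2 / 2 * V)"
    using exp_ge_add_one_self[of "s\<^sup>2 / 2 * V"] by simp
  finally show ?thesis by (simp add: m_def V_def)
qed

text \<open>
  Tensorization, by induction on the number of coordinates.  Averaging \<open>f\<close> over one coordinate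
  \<open>i\<close> gives a function \<open>h\<close> of the remaining ones that inherits the bounded differences.  With
  the other coordinates fixed, the fluctuation of \<open>f\<close> around \<open>h\<close> is handled by the
  one-variable bound, and the fluctuation of \<open>h\<close> around its mean by the induction hypothesis.
  The bound for a single coordinate depends only on \<open>c i\<close>, not on the values of the other
  coordinates, so it is a constant that can be pulled out of the outer integral.
\<close>

lemma (in product_prob_space) mgf_le_of_bounded_differences:
  fixes f :: "('i \<Rightarrow> 'a) \<Rightarrow> real" and c :: "'i \<Rightarrow> 'a \<Rightarrow> 'a \<Rightarrow> real"
  assumes J: "finite J"
    and f: "f \<in> borel_measurable (Pi\<^sub>M J M)"
    and bd: "\<And>x. x \<in> space (Pi\<^sub>M J M) \<Longrightarrow> \<bar>f x\<bar> \<le> K"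
    and c: "\<And>i. i \<in> J \<Longrightarrow> (\<lambda>p. c i (fst p) (snd p)) \<in> borel_measurable (M i \<Otimes>\<^sub>M M i)"
    and diff: "\<And>x i a. x \<in> space (Pi\<^sub>M J M) \<Longrightarrow> i \<in> J \<Longrightarrow> a \<in> space (M i) \<Longrightarrow>
                 \<bar>f x - f (x(i := a))\<bar> \<le> c i (x i) a"
    and cB: "\<And>i a b. i \<in> J \<Longrightarrow> a \<in> space (M i) \<Longrightarrow> b \<in> space (M i) \<Longrightarrow> c i a b \<le> B"
    and s: "0 \<le> s" "s * B \<le> 1"
  shows "(\<integral>x. exp (s * (f x - (\<integral>y. f y \<partial>Pi\<^sub>M J M))) \<partial>Pi\<^sub>M J M)
           \<le> exp (s\<^sup>2 / 2 * (\<Sum>i\<in>J. \<integral>p. (c i (fst p) (snd p))\<^sup>2 \<partial>(M i \<Otimes>\<^sub>M M i)))"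
  using J f bd c diff cB
proof (induction J arbitrary: f rule: finite_induct)
  case empty
  then show ?case
    by (simp add: PiM_empty lebesgue_integral_count_space_finite)
next
  case (insert i J)
  note [measurable] = insert.prems(1)
  define Q where "Q = Pi\<^sub>M J M"
  define Q' where "Q' = Pi\<^sub>M (insert i J) M"
  interpret PJ: prob_space Q unfolding Q_def by (rule prob_space_PiM) (rule prob_space)
  interpret PJ': prob_space Q' unfolding Q'_def by (rule prob_space_PiM) (rule prob_space)
  have fm [measurable]: "f \<in> borel_measurable Q'" unfolding Q'_def by fact
  have upd: "x(i := a) \<in> space Q'" if "x \<in> space Q" "a \<in> space (M i)" for x a
    using that by (auto simp: Q_def Q'_def space_PiM PiE_iff extensional_def)
  have [measurable]: "(\<lambda>p. (fst p)(i := snd p)) \<in> measurable (Q \<Otimes>\<^sub>M M i) Q'"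
    using measurable_add_dim[of i J M] by (simp add: Q_def Q'_def case_prod_beta')
  have f2 [measurable]: "(\<lambda>p. f ((fst p)(i := snd p))) \<in> borel_measurable (Q \<Otimes>\<^sub>M M i)"
    by measurable
  define h where "h x = (\<integral>a. f (x(i := a)) \<partial>M i)" for x
  have sect [measurable]: "(\<lambda>a. f (x(i := a))) \<in> borel_measurable (M i)" if "x \<in> space Q" for x
    using measurable_compose[OF measurable_Pair1'[OF that] f2] by simp
  have h [measurable]: "h \<in> borel_measurable Q"
    unfolding h_def using M.borel_measurable_lebesgue_integral[of "\<lambda>x a. f (x(i := a))" Q i] f2
    by (simp add: case_prod_beta')
  have ints: "integrable (M i) (\<lambda>a. f (x(i := a)))" if "x \<in> space Q" for x
    using that insert.prems(2) upd
    by (intro M.integrable_const_bound[where B = K])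
       (auto intro!: AE_I2 simp: Q'_def)
  have hK: "\<bar>h x\<bar> \<le> K" if x: "x \<in> space Q" for x
  proof -
    have "\<bar>h x\<bar> \<le> (\<integral>a. \<bar>f (x(i := a))\<bar> \<partial>M i)"
      unfolding h_def using integral_norm_bound[of "M i" "\<lambda>a. f (x(i := a))"] by simp
    also have "\<dots> \<le> (\<integral>a. K \<partial>M i)"
      by (intro integral_mono) (use x ints insert.prems(2) upd in \<open>auto simp: Q'_def\<close>)
    finally show ?thesis by (simp add: M.prob_space)
  qed
  have hdiff: "\<bar>h x - h (x(k := a))\<bar> \<le> c k (x k) a"
    if x: "x \<in> space Q" and k: "k \<in> J" and a: "a \<in> space (M k)" for x k a
  proof -
    have x': "x(k := a) \<in> space Q"
      using x k a by (auto simp: Q_def space_PiM PiE_iff extensional_def)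
    have ki: "k \<noteq> i" using k insert.hyps by auto
    have "h x - h (x(k := a)) = (\<integral>b. f (x(i := b)) - f (x(k := a, i := b)) \<partial>M i)"
      unfolding h_def using ints[OF x] ints[OF x'] by simp
    also have "\<bar>\<dots>\<bar> \<le> (\<integral>b. \<bar>f (x(i := b)) - f (x(k := a, i := b))\<bar> \<partial>M i)"
      using integral_norm_bound[of "M i" "\<lambda>b. f (x(i := b)) - f (x(k := a, i := b))"] by simp
    also have "\<dots> \<le> (\<integral>b. c k (x k) a \<partial>M i)"
    proof (intro integral_mono)
      fix b assume b: "b \<in> space (M i)"
      show "\<bar>f (x(i := b)) - f (x(k := a, i := b))\<bar> \<le> c k (x k) a"
        using insert.prems(4)[of "x(i := b)" k a] upd[OF x b] k a ki
        by (simp add: Q'_def fun_upd_twist[OF ki] del: fun_upd_apply) (simp add: fun_upd_def)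
    qed (use ints[OF x] ints[OF x'] in auto)
    finally show ?thesis by (simp add: M.prob_space)
  qed
  define m where "m = (\<integral>y. f y \<partial>Q')"
  define V where "V k = (\<integral>p. (c k (fst p) (snd p))\<^sup>2 \<partial>(M k \<Otimes>\<^sub>M M k))" for k
  have intf: "integrable Q' f"
    using insert.prems(2) by (intro PJ'.integrable_const_bound[of _ K]) (auto intro!: AE_I2 simp: Q'_def)
  have m_eq: "m = (\<integral>x. h x \<partial>Q)"
    using product_integral_insert[OF insert.hyps intf[unfolded Q'_def]]
    by (simp add: m_def h_def Q_def Q'_def)
  have exp_le: "exp (s * (f x - r)) \<le> exp (s * (K - r))" if "x \<in> space Q'" for x r
    using insert.prems(2)[of x] that s by (auto intro!: mult_left_mono simp: Q'_def)
  have inte: "integrable Q' (\<lambda>x. exp (s * (f x - m)))"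
    using exp_le by (intro PJ'.integrable_const_bound[of _ "exp (s * (K - m))"]) (auto intro!: AE_I2)
  have intse: "integrable (M i) (\<lambda>a. exp (s * (f (x(i := a)) - r)))" if "x \<in> space Q" for x r
    using that exp_le upd
    by (intro M.integrable_const_bound[where B = "exp (s * (K - r))"])
       (auto intro!: AE_I2)
  have inth: "integrable Q (\<lambda>x. exp (s * (h x - m)))"
  proof (intro PJ.integrable_const_bound[of _ "exp (s * (K - m))"] AE_I2)
    fix x assume "x \<in> space Q"
    then show "norm (exp (s * (h x - m))) \<le> exp (s * (K - m))"
      using hK[of x] s by (auto intro!: mult_left_mono)
  qed auto
  have sec: "(\<integral>a. exp (s * (f (x(i := a)) - h x)) \<partial>M i) \<le> exp (s\<^sup>2 / 2 * V i)"
    if x: "x \<in> space Q" for x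
    unfolding h_def V_def
  proof (rule prob_space.mgf_le_of_oscillation[OF prob_space, where K = K and B = B])
    fix a b assume a: "a \<in> space (M i)" and b: "b \<in> space (M i)"
    show "\<bar>f (x(i := a))\<bar> \<le> K" using insert.prems(2) upd[OF x a] by (auto simp: Q'_def)
    show "\<bar>f (x(i := a)) - f (x(i := b))\<bar> \<le> c i a b"
      using insert.prems(4)[of "x(i := a)" i b] upd[OF x a] b
      by (simp add: Q'_def del: fun_upd_apply) simp
    show "c i a b \<le> B" using insert.prems(5) a b by auto
  qed (use x s insert.prems(3) in auto)
  have "(\<integral>x. exp (s * (f x - m)) \<partial>Q') = (\<integral>x. (\<integral>a. exp (s * (f (x(i := a)) - m)) \<partial>M i) \<partial>Q)"
    using product_integral_insert[OF insert.hyps inte[unfolded Q'_def]] by (simp add: Q_def Q'_def)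
  also have "\<dots> \<le> (\<integral>x. exp (s * (h x - m)) * exp (s\<^sup>2 / 2 * V i) \<partial>Q)"
  proof (rule integral_mono')
    fix x assume x: "x \<in> space Q"
    have "(\<integral>a. exp (s * (f (x(i := a)) - m)) \<partial>M i)
        = (\<integral>a. exp (s * (h x - m)) * exp (s * (f (x(i := a)) - h x)) \<partial>M i)"
      by (simp add: algebra_simps flip: exp_add)
    also have "\<dots> = exp (s * (h x - m)) * (\<integral>a. exp (s * (f (x(i := a)) - h x)) \<partial>M i)"
      by simp
    also have "\<dots> \<le> exp (s * (h x - m)) * exp (s\<^sup>2 / 2 * V i)"
      by (intro mult_left_mono sec x) auto
    finally show "(\<integral>a. exp (s * (f (x(i := a)) - m)) \<partial>M i) \<le> exp (s * (h x - m)) * exp (s\<^sup>2 / 2 * V i)" .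
  qed (use inth in auto)
  also have "\<dots> = (\<integral>x. exp (s * (h x - m)) \<partial>Q) * exp (s\<^sup>2 / 2 * V i)"
    by simp
  also have "(\<integral>x. exp (s * (h x - m)) \<partial>Q) \<le> exp (s\<^sup>2 / 2 * (\<Sum>k\<in>J. V k))"
    unfolding m_eq Q_def V_def
    by (rule insert.IH)
       (use h hK hdiff insert.prems(3,5) in \<open>auto simp: Q_def simp del: fun_upd_apply\<close>)
  also have "exp (s\<^sup>2 / 2 * (\<Sum>k\<in>J. V k)) * exp (s\<^sup>2 / 2 * V i) = exp (s\<^sup>2 / 2 * (\<Sum>k\<in>insert i J. V k))"
    using insert.hyps by (simp add: exp_add[symmetric] algebra_simps)
  finally show ?case
    unfolding m_def V_def Q'_def by simp
qed

text \<open>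
  Chernoff's bound with the parameter \<open>s = sqrt (2 * t / V)\<close>, which is optimal for the square
  root term alone, when it satisfies the constraint \<open>s * B \<le> 1\<close>, and \<open>s = 1 / B\<close> otherwise.  In
  the latter regime, which contains \<open>V = 0\<close>, the linear term \<open>B * t\<close> alone yields
  \<open>exp (- t)\<close> and the square root term compensates the second-order one.
\<close>

lemma (in product_prob_space) bounded_differences_upper_tail:
  fixes f :: "('i \<Rightarrow> 'a) \<Rightarrow> real" and c :: "'i \<Rightarrow> 'a \<Rightarrow> 'a \<Rightarrow> real"
  defines "V \<equiv> \<lambda>J. \<Sum>i\<in>J. \<integral>p. (c i (fst p) (snd p))\<^sup>2 \<partial>(M i \<Otimes>\<^sub>M M i)"
  assumes J: "finite J"
    and f [measurable]: "f \<in> borel_measurable (Pi\<^sub>M J M)"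
    and bd: "\<And>x. x \<in> space (Pi\<^sub>M J M) \<Longrightarrow> \<bar>f x\<bar> \<le> K"
    and c: "\<And>i. i \<in> J \<Longrightarrow> (\<lambda>p. c i (fst p) (snd p)) \<in> borel_measurable (M i \<Otimes>\<^sub>M M i)"
    and diff: "\<And>x i a. x \<in> space (Pi\<^sub>M J M) \<Longrightarrow> i \<in> J \<Longrightarrow> a \<in> space (M i) \<Longrightarrow>
                 \<bar>f x - f (x(i := a))\<bar> \<le> c i (x i) a"
    and cB: "\<And>i a b. i \<in> J \<Longrightarrow> a \<in> space (M i) \<Longrightarrow> b \<in> space (M i) \<Longrightarrow> c i a b \<le> B"
    and B: "B > 0" and t: "t > 0"
  shows "measure (Pi\<^sub>M J M) {x \<in> space (Pi\<^sub>M J M).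
           f x - (\<integral>y. f y \<partial>Pi\<^sub>M J M) \<ge> sqrt (2 * V J * t) + B * t} \<le> exp (- t)"
proof -
  interpret PJ: prob_space "Pi\<^sub>M J M" by (rule prob_space_PiM) (rule prob_space)
  define m where "m = (\<integral>y. f y \<partial>Pi\<^sub>M J M)"
  define r where "r = sqrt (2 * V J * t) + B * t"
  have V0: "V J \<ge> 0" unfolding V_def by (intro sum_nonneg) auto
  have chernoff: "measure (Pi\<^sub>M J M) {x \<in> space (Pi\<^sub>M J M). f x - m \<ge> r} \<le> exp (- s * r + s\<^sup>2 / 2 * V J)"
    if s: "s > 0" "s * B \<le> 1" for s
  proof -
    have int: "integrable (Pi\<^sub>M J M) (\<lambda>x. exp (s * (f x - m)))"
      using bd s by (intro PJ.integrable_const_bound[of _ "exp (s * (K - m))"])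
        (auto intro!: AE_I2 mult_left_mono dest: abs_le_D1)
    have "measure (Pi\<^sub>M J M) {x \<in> space (Pi\<^sub>M J M). f x - m \<ge> r}
        \<le> exp (- s * r) * (\<integral>x. exp (s * (f x - m)) \<partial>Pi\<^sub>M J M)"
      using PJ.Chernoff_ineq_ge[OF s(1), of "space (Pi\<^sub>M J M)" "\<lambda>x. f x - m" r] int
      by (simp add: set_integrable_def set_lebesgue_integral_def indicator_def
            cong: Bochner_Integration.integral_cong Bochner_Integration.integrable_cong)
    also have "\<dots> \<le> exp (- s * r) * exp (s\<^sup>2 / 2 * V J)"
      unfolding m_def V_def
      by (intro mult_left_mono mgf_le_of_bounded_differences[OF J f bd c diff cB]) (use s in auto)
    finally show ?thesis by (simp only: exp_add)
  qed
  have "\<exists>s>0. s * B \<le> 1 \<and> - s * r + s\<^sup>2 / 2 * V J \<le> - t"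
  proof (cases "V J \<ge> 2 * t * B\<^sup>2")
    case True
    have V: "V J > 0" using True B t by (smt (verit) mult_pos_pos zero_less_power)
    define s where "s = sqrt (2 * t / V J)"
    have "2 * t / V J \<le> (1 / B)\<^sup>2"
      using True V B by (simp add: field_simps)
    then have "s \<le> 1 / B" unfolding s_def using B real_le_lsqrt by auto
    then have sB: "s * B \<le> 1" using B by (simp add: field_simps)
    have s2: "s\<^sup>2 = 2 * t / V J" using V t by (simp add: s_def)
    have "s * sqrt (2 * V J * t) = sqrt ((2 * t)\<^sup>2)"
      using V by (simp add: s_def power2_eq_square flip: real_sqrt_mult)
    then have "s * sqrt (2 * V J * t) = 2 * t" using t by (simp only: real_sqrt_abs abs_of_pos mult_pos_pos zero_less_numeral)
    moreover have "s * (B * t) \<ge> 0" using B t V by (simp add: s_def)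
    ultimately have "- s * r + s\<^sup>2 / 2 * V J \<le> - t"
      using V s2 by (simp add: r_def algebra_simps)
    then show ?thesis using sB V t by (intro exI[of _ s]) (auto simp: s_def)
  next
    case False
    have "V J = sqrt (V J) * sqrt (V J)" using V0 by simp
    also have "\<dots> \<le> sqrt (2 * t * B\<^sup>2) * sqrt (V J)"
      using False V0 by (intro mult_right_mono) auto
    also have "\<dots> = B * sqrt (2 * V J * t)"
      using B by (simp add: real_sqrt_mult)
    finally have le: "V J \<le> B * sqrt (2 * V J * t)" .
    have ge0: "0 \<le> B * sqrt (2 * V J * t)" using B V0 t by simp
    have "- (1 / B) * r + (1 / B)\<^sup>2 / 2 * V J = - t + (V J / 2 - B * sqrt (2 * V J * t)) / B\<^sup>2"
      using B by (simp add: r_def field_simps power2_eq_square)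
    also have "\<dots> \<le> - t"
      using le V0 B ge0 by (simp add: divide_nonpos_pos)
    finally show ?thesis using B by (intro exI[of _ "1 / B"]) auto
  qed
  then obtain s where "s > 0" "s * B \<le> 1" "- s * r + s\<^sup>2 / 2 * V J \<le> - t" by auto
  with chernoff[of s] show ?thesis
    unfolding m_def r_def by (meson exp_le_cancel_iff order_trans)
qed

lemma (in product_prob_space) bounded_differences_concentration:
  fixes f :: "('i \<Rightarrow> 'a) \<Rightarrow> real" and c :: "'i \<Rightarrow> 'a \<Rightarrow> 'a \<Rightarrow> real"
  defines "V \<equiv> \<lambda>J. \<Sum>i\<in>J. \<integral>p. (c i (fst p) (snd p))\<^sup>2 \<partial>(M i \<Otimes>\<^sub>M M i)"
  assumes J: "finite J"
    and f [measurable]: "f \<in> borel_measurable (Pi\<^sub>M J M)"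
    and bd: "\<And>x. x \<in> space (Pi\<^sub>M J M) \<Longrightarrow> \<bar>f x\<bar> \<le> K"
    and c: "\<And>i. i \<in> J \<Longrightarrow> (\<lambda>p. c i (fst p) (snd p)) \<in> borel_measurable (M i \<Otimes>\<^sub>M M i)"
    and diff: "\<And>x i a. x \<in> space (Pi\<^sub>M J M) \<Longrightarrow> i \<in> J \<Longrightarrow> a \<in> space (M i) \<Longrightarrow>
                 \<bar>f x - f (x(i := a))\<bar> \<le> c i (x i) a"
    and cB: "\<And>i a b. i \<in> J \<Longrightarrow> a \<in> space (M i) \<Longrightarrow> b \<in> space (M i) \<Longrightarrow> c i a b \<le> B"
    and B: "B > 0" and t: "t > 0"
  shows "measure (Pi\<^sub>M J M) {x \<in> space (Pi\<^sub>M J M).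
           \<bar>f x - (\<integral>y. f y \<partial>Pi\<^sub>M J M)\<bar> \<ge> sqrt (2 * V J * t) + B * t} \<le> 2 * exp (- t)"
proof -
  interpret PJ: prob_space "Pi\<^sub>M J M" by (rule prob_space_PiM) (rule prob_space)
  define m where "m = (\<integral>y. f y \<partial>Pi\<^sub>M J M)"
  define r where "r = sqrt (2 * V J * t) + B * t"
  let ?U = "{x \<in> space (Pi\<^sub>M J M). f x - m \<ge> r}"
  let ?L = "{x \<in> space (Pi\<^sub>M J M). - f x - (\<integral>y. - f y \<partial>Pi\<^sub>M J M) \<ge> r}"
  have U: "measure (Pi\<^sub>M J M) ?U \<le> exp (- t)"
    unfolding m_def r_def V_def
    by (rule bounded_differences_upper_tail[OF J f bd c diff cB B t])
  have L: "measure (Pi\<^sub>M J M) ?L \<le> exp (- t)"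
    unfolding r_def V_def
  proof (rule bounded_differences_upper_tail[OF J _ _ c _ cB B t])
    show "\<bar>- f x\<bar> \<le> K" if "x \<in> space (Pi\<^sub>M J M)" for x using bd[OF that] by simp
    show "\<bar>- f x - - f (x(i := a))\<bar> \<le> c i (x i) a"
      if "x \<in> space (Pi\<^sub>M J M)" "i \<in> J" "a \<in> space (M i)" for x i a
      using diff[OF that] by simp
  qed auto
  have "measure (Pi\<^sub>M J M) {x \<in> space (Pi\<^sub>M J M). \<bar>f x - m\<bar> \<ge> r} \<le> measure (Pi\<^sub>M J M) (?U \<union> ?L)"
    by (intro PJ.finite_measure_mono) (auto simp: m_def abs_real_def)
  also have "\<dots> \<le> measure (Pi\<^sub>M J M) ?U + measure (Pi\<^sub>M J M) ?L"
    by (intro measure_Un_le) auto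
  finally show ?thesis using U L by (simp add: m_def r_def)
qed

section \<open>Couplings with empirical measures\<close>

lemma sets_empirical_measure [simp]: "sets (empirical_measure J y) = sets borel"
  by (simp add: empirical_measure_def sets.sigma_sets_eq[of borel, simplified])

text \<open>
  Integrals against an empirical measure become finite averages once it is seen as the image of
  the uniform measure on the index set.
\<close>

lemma empirical_measure_eq_distr:
  fixes y :: "'i \<Rightarrow> 'a::topological_space"
  assumes J: "finite J" "J \<noteq> {}"
  shows "empirical_measure J y = distr (uniform_count_measure J) borel y"
proof (rule measure_eqI)
  show "sets (empirical_measure J y) = sets (distr (uniform_count_measure J) borel y)"
    by simp
  fix A assume "A \<in> sets (empirical_measure J y)"
  then have A: "A \<in> sets borel"
    by simp
  have "emeasure (distr (uniform_count_measure J) borel y) A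
      = ennreal (real (card {i \<in> J. y i \<in> A}) / real (card J))"
    using A J by (subst emeasure_distr)
      (auto simp: emeasure_uniform_count_measure measurable_def space_uniform_count_measure
        sets_uniform_count_measure intro!: arg_cong[where f = card])
  also have "\<dots> = (\<Sum>i\<in>J. emeasure (return borel (y i)) A) / of_nat (card J)"
    using A J by (simp add: indicator_def sum.If_cases Int_def card_gt_0_iff
        ennreal_of_nat_eq_real_of_nat divide_ennreal)
  finally show "emeasure (empirical_measure J y) A = emeasure (distr (uniform_count_measure J) borel y) A"
    using A by (simp only: emeasure_empirical_measure)
qed

lemma prob_space_empirical_measure:
  fixes y :: "'i \<Rightarrow> 'a::topological_space"
  assumes J: "finite J" "J \<noteq> {}"
  shows "prob_space (empirical_measure J y)"
  unfolding empirical_measure_eq_distr[OF J]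
  by (rule prob_space.prob_space_distr[OF prob_space_uniform_count_measure[OF J]])
     (simp add: measurable_def space_uniform_count_measure sets_uniform_count_measure)

lemma
  fixes \<pi> :: "('b::topological_space \<times> 'a::topological_space) measure" and y :: "'i \<Rightarrow> 'a" and h :: "'a \<Rightarrow> real"
  assumes J: "finite J" "J \<noteq> {}"
    and \<pi>: "sets \<pi> = sets (borel \<Otimes>\<^sub>M borel)" "distr \<pi> borel snd = empirical_measure J y"
    and h [measurable]: "h \<in> borel_measurable borel"
  shows integrable_snd_marginal_empirical: "integrable \<pi> (\<lambda>p. h (snd p))"
    and integral_snd_marginal_empirical: "(\<integral>p. h (snd p) \<partial>\<pi>) = (\<Sum>i\<in>J. h (y i)) / real (card J)"
proof -
  have snd_m: "snd \<in> measurable \<pi> borel"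
    using measurable_cong_sets[OF \<pi>(1) refl] measurable_snd by blast
  have y_m: "y \<in> measurable (uniform_count_measure J) borel"
    by (simp add: measurable_def space_uniform_count_measure sets_uniform_count_measure)
  have eq: "distr \<pi> borel snd = distr (uniform_count_measure J) borel y"
    using \<pi>(2) empirical_measure_eq_distr[OF J] by simp
  have "integrable (uniform_count_measure J) (\<lambda>i. h (y i))"
    unfolding uniform_count_measure_def using J by (intro integrable_point_measure_finite)
  then have "integrable (distr \<pi> borel snd) h"
    unfolding eq by (subst integrable_distr_eq[OF y_m]) auto
  then show "integrable \<pi> (\<lambda>p. h (snd p))"
    by (subst (asm) integrable_distr_eq[OF snd_m]) auto
  have "(\<integral>p. h (snd p) \<partial>\<pi>) = integral\<^sup>L (distr \<pi> borel snd) h"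
    by (subst integral_distr[OF snd_m]) auto
  also have "\<dots> = (\<integral>i. h (y i) \<partial>uniform_count_measure J)"
    unfolding eq by (subst integral_distr[OF y_m]) auto
  also have "\<dots> = (\<Sum>i\<in>J. h (y i)) / real (card J)"
    using J by (simp add: integral_uniform_count_measure)
  finally show "(\<integral>p. h (snd p) \<partial>\<pi>) = (\<Sum>i\<in>J. h (y i)) / real (card J)" .
qed

lemma AE_snd_marginal_empirical:
  fixes \<pi> :: "('b::topological_space \<times> 'a::t1_space) measure" and y :: "'i \<Rightarrow> 'a"
  assumes J: "finite J" "J \<noteq> {}"
    and \<pi>: "sets \<pi> = sets (borel \<Otimes>\<^sub>M borel)" "distr \<pi> borel snd = empirical_measure J y"
  shows "AE p in \<pi>. snd p \<in> y ` J"
proof -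
  have snd_m: "snd \<in> measurable \<pi> borel"
    using measurable_cong_sets[OF \<pi>(1) refl] measurable_snd by blast
  have y_m: "y \<in> measurable (uniform_count_measure J) borel"
    by (simp add: measurable_def space_uniform_count_measure sets_uniform_count_measure)
  have meas: "{v \<in> space borel. v \<in> y ` J} \<in> sets borel"
    using J by (simp add: borel_closed finite_imp_closed)
  have "AE i in uniform_count_measure J. y i \<in> y ` J"
    by (auto intro!: AE_I2 simp: space_uniform_count_measure)
  then have "AE v in distr \<pi> borel snd. v \<in> y ` J"
    unfolding \<pi>(2) empirical_measure_eq_distr[OF J]
    by (subst AE_distr_iff[OF y_m meas]) auto
  then show ?thesis
    by (subst (asm) AE_distr_iff[OF snd_m meas]) auto
qed

text \<open>
  The conditional mean of \<open>g\<close> on a uniformly chosen index, given that the sample value at this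
  index is \<open>v\<close>.  Several indices may share the value \<open>v\<close>, so an atom of the empirical measure
  does not determine its index.  Sums of indicators make Borel measurability in \<open>v\<close> evident;
  outside the sample the quotient is \<open>0\<close>.
\<close>

definition fibre_mean :: "'i set \<Rightarrow> ('i \<Rightarrow> 'a) \<Rightarrow> ('i \<Rightarrow> real) \<Rightarrow> 'a \<Rightarrow> real" where
  "fibre_mean J y g v = (\<Sum>i\<in>J. g i * indicator {y i} v) / (\<Sum>i\<in>J. indicator {y i} v)"

lemma borel_measurable_fibre_mean [measurable]:
  fixes y :: "'i \<Rightarrow> 'a::t1_space"
  shows "fibre_mean J y g \<in> borel_measurable borel"
proof -
  have [measurable]: "indicat_real {y i} \<in> borel_measurable (borel :: 'a measure)" for i
    by (rule borel_measurable_indicator) (simp add: borel_closed)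
  show ?thesis
    unfolding fibre_mean_def by measurable
qed

lemma fibre_size_pos:
  assumes "finite J" "k \<in> J"
  shows "(\<Sum>i\<in>J. indicator {y i} (y k)) > (0::real)"
proof -
  have "(\<Sum>i\<in>J. indicator {y i} (y k)) \<ge> (indicator {y k} (y k) :: real)"
    by (rule member_le_sum) (use assms in auto)
  then show ?thesis by simp
qed

lemma fibre_mean_const:
  assumes "finite J" "v \<in> y ` J"
  shows "fibre_mean J y (\<lambda>_. r) v = r"
proof -
  have "(\<Sum>i\<in>J. indicator {y i} v) > (0::real)"
    using assms fibre_size_pos[OF assms(1), of _ y] by blast
  then show ?thesis
    unfolding fibre_mean_def sum_distrib_left[symmetric] by simp
qed

lemma fibre_mean_add: "fibre_mean J y (\<lambda>i. g i + h i) v = fibre_mean J y g v + fibre_mean J y h v"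
  by (simp only: fibre_mean_def distrib_right sum.distrib add_divide_distrib)

lemma fibre_mean_sum_mult:
  "(\<Sum>j\<in>J'. fibre_mean J y (\<lambda>i. P i j) v * r j) = fibre_mean J y (\<lambda>i. \<Sum>j\<in>J'. P i j * r j) v"
proof -
  have "(\<Sum>j\<in>J'. (\<Sum>i\<in>J. P i j * indicator {y i} v) * r j)
      = (\<Sum>i\<in>J. (\<Sum>j\<in>J'. P i j * r j) * indicator {y i} v)"
    unfolding sum_distrib_right
    by (subst sum.swap) (intro sum.cong refl, simp add: mult_ac)
  then show ?thesis
    by (simp add: fibre_mean_def sum_divide_distrib[symmetric])
qed

lemma fibre_mean_mono:
  assumes "\<And>i. i \<in> J \<Longrightarrow> y i = v \<Longrightarrow> g i \<le> h i"
  shows "fibre_mean J y g v \<le> fibre_mean J y h v"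
  unfolding fibre_mean_def
proof (intro divide_right_mono sum_mono sum_nonneg)
  fix i assume "i \<in> J"
  then show "g i * indicator {y i} v \<le> h i * indicator {y i} v"
    using assms[of i] by (cases "y i = v") auto
qed auto

text \<open>
  The tower property: averaging the conditional means gives back the overall mean.  Exchanging
  the two sums, each \<open>g i\<close> is counted once for every index in its fibre and divided by the size
  of this fibre.
\<close>

lemma sum_fibre_mean:
  assumes J: "finite J"
  shows "(\<Sum>k\<in>J. fibre_mean J y g (y k)) = (\<Sum>k\<in>J. g k)"
proof -
  let ?N = "\<lambda>v. \<Sum>i\<in>J. indicator {y i} v :: real"
  have "(\<Sum>k\<in>J. fibre_mean J y g (y k)) = (\<Sum>k\<in>J. \<Sum>i\<in>J. g i * (indicator {y i} (y k) / ?N (y k)))"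
    by (simp add: fibre_mean_def sum_divide_distrib)
  also have "\<dots> = (\<Sum>i\<in>J. \<Sum>k\<in>J. g i * (indicator {y i} (y k) / ?N (y k)))"
    by (rule sum.swap)
  also have "\<dots> = (\<Sum>i\<in>J. g i)"
  proof (rule sum.cong[OF refl])
    fix i assume i: "i \<in> J"
    have "(\<Sum>k\<in>J. g i * (indicator {y i} (y k) / ?N (y k)))
        = (\<Sum>k\<in>J. g i * (indicator {y k} (y i) / ?N (y i)))"
      by (intro sum.cong refl) (auto simp: indicator_def)
    also have "\<dots> = g i * (?N (y i) / ?N (y i))"
      by (simp only: sum_distrib_left[symmetric] sum_divide_distrib[symmetric])
    finally show "(\<Sum>k\<in>J. g i * (indicator {y i} (y k) / ?N (y k))) = g i"
      using fibre_size_pos[OF J i, of y] by simp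
  qed
  finally show ?thesis .
qed

text \<open>
  Keep the source point of \<open>\<pi>\<close>, and replace a target point \<open>v\<close> by \<open>x j\<close> with probability
  \<open>K j v\<close>.  Because the new target is drawn from a finite family, this composition of \<open>\<pi>\<close> with a
  Markov kernel can be written as the image of a measure with a density on the product of the
  index set and the space of \<open>\<pi>\<close>.
\<close>

definition reroute ::
  "('b::topological_space \<times> 'a::topological_space) measure \<Rightarrow> 'j set \<Rightarrow> ('j \<Rightarrow> 'a \<Rightarrow> real) \<Rightarrow>
    ('j \<Rightarrow> 'c::topological_space) \<Rightarrow> ('b \<times> 'c) measure" where
  "reroute \<pi> J K x =
     distr (density (count_space J \<Otimes>\<^sub>M \<pi>) (\<lambda>q. ennreal (K (fst q) (snd (snd q)))))
       (borel \<Otimes>\<^sub>M borel) (\<lambda>q. (fst (snd q), x (fst q)))"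

lemma nn_integral_reroute:
  fixes \<pi> :: "('b::topological_space \<times> 'a::topological_space) measure" and x :: "'j \<Rightarrow> 'c::topological_space"
  assumes J: "finite J"
    and \<pi>: "prob_space \<pi>" "sets \<pi> = sets (borel \<Otimes>\<^sub>M borel)"
    and K: "\<And>j. j \<in> J \<Longrightarrow> K j \<in> borel_measurable borel"
    and g: "g \<in> borel_measurable (borel \<Otimes>\<^sub>M borel)"
  shows "(\<integral>\<^sup>+q. g q \<partial>reroute \<pi> J K x) = (\<Sum>j\<in>J. \<integral>\<^sup>+p. ennreal (K j (snd p)) * g (fst p, x j) \<partial>\<pi>)"
proof -
  interpret prob_space \<pi> by fact
  note [measurable_cong] = \<pi>(2)
  note [measurable] = g K
  have [measurable]: "(\<lambda>q. (fst (snd q), x (fst q))) \<in> count_space J \<Otimes>\<^sub>M \<pi> \<rightarrow>\<^sub>M borel \<Otimes>\<^sub>M borel"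
    by (rule measurable_pair_measure_countable1) (use J in \<open>auto simp: countable_finite\<close>)
  have [measurable]: "(\<lambda>q. ennreal (K (fst q) (snd (snd q)))) \<in> borel_measurable (count_space J \<Otimes>\<^sub>M \<pi>)"
    by (rule measurable_pair_measure_countable1) (use J in \<open>auto simp: countable_finite\<close>)
  have "(\<integral>\<^sup>+q. g q \<partial>reroute \<pi> J K x)
      = (\<integral>\<^sup>+q. ennreal (K (fst q) (snd (snd q))) * g (fst (snd q), x (fst q)) \<partial>(count_space J \<Otimes>\<^sub>M \<pi>))"
    unfolding reroute_def by (simp add: nn_integral_distr nn_integral_density)
  also have "\<dots> = (\<integral>\<^sup>+j. \<integral>\<^sup>+p. ennreal (K j (snd p)) * g (fst p, x j) \<partial>\<pi> \<partial>count_space J)"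
    by (subst nn_integral_fst[symmetric]) simp_all
  finally show ?thesis using J by (simp add: nn_integral_count_space_finite)
qed

lemma reroute_in_couplings:
  fixes \<pi> :: "('a::topological_space \<times> 'a) measure" and x :: "'j \<Rightarrow> 'a"
  assumes J: "finite J"
    and \<pi>: "prob_space \<pi>" "sets \<pi> = sets (borel \<Otimes>\<^sub>M borel)"
    and K: "\<And>j. j \<in> J \<Longrightarrow> K j \<in> borel_measurable borel"
    and K0: "\<And>j v. j \<in> J \<Longrightarrow> K j v \<ge> 0"
    and K1: "AE p in \<pi>. (\<Sum>j\<in>J. K j (snd p)) = 1"
    and Kint: "\<And>j. j \<in> J \<Longrightarrow> (\<integral>\<^sup>+p. ennreal (K j (snd p)) \<partial>\<pi>) = 1 / of_nat (card J)"
  shows "reroute \<pi> J K x \<in> couplings (distr \<pi> borel fst) (empirical_measure J x)"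
proof -
  interpret prob_space \<pi> by fact
  note [measurable_cong] = \<pi>(2)
  note [measurable] = K
  have sets_r [measurable_cong]: "sets (reroute \<pi> J K x) = sets (borel \<Otimes>\<^sub>M borel)"
    by (simp add: reroute_def)
  have fst_eq: "distr (reroute \<pi> J K x) borel fst = distr \<pi> borel fst"
  proof (rule measure_eqI)
    fix A :: "'a set" assume "A \<in> sets (distr (reroute \<pi> J K x) borel fst)"
    then have A [measurable]: "A \<in> sets borel" by simp
    have "emeasure (distr (reroute \<pi> J K x) borel fst) A = (\<integral>\<^sup>+q. indicator A (fst q) \<partial>reroute \<pi> J K x)"
      using nn_integral_distr[of fst "reroute \<pi> J K x" borel "indicator A"] by simp
    also have "\<dots> = (\<Sum>j\<in>J. \<integral>\<^sup>+p. ennreal (K j (snd p)) * indicator A (fst p) \<partial>\<pi>)"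
      by (subst nn_integral_reroute[OF J \<pi> K]) auto
    also have "\<dots> = (\<integral>\<^sup>+p. (\<Sum>j\<in>J. ennreal (K j (snd p)) * indicator A (fst p)) \<partial>\<pi>)"
      by (subst nn_integral_sum) auto
    also have "\<dots> = (\<integral>\<^sup>+p. indicator A (fst p) \<partial>\<pi>)"
    proof (rule nn_integral_cong_AE)
      show "AE p in \<pi>. (\<Sum>j\<in>J. ennreal (K j (snd p)) * indicator A (fst p)) = indicator A (fst p)"
        using K1
      proof eventually_elim
        case (elim p)
        have "(\<Sum>j\<in>J. ennreal (K j (snd p))) = ennreal (\<Sum>j\<in>J. K j (snd p))"
          using K0 by (simp add: sum_ennreal)
        then show ?case using elim by (simp flip: sum_distrib_right)
      qed
    qed
    also have "\<dots> = emeasure (distr \<pi> borel fst) A"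
      using nn_integral_distr[of fst \<pi> borel "indicator A"] by simp
    finally show "emeasure (distr (reroute \<pi> J K x) borel fst) A = emeasure (distr \<pi> borel fst) A" .
  qed simp
  have snd_eq: "distr (reroute \<pi> J K x) borel snd = empirical_measure J x"
  proof (rule measure_eqI)
    fix A :: "'a set" assume "A \<in> sets (distr (reroute \<pi> J K x) borel snd)"
    then have A [measurable]: "A \<in> sets borel" by simp
    have "emeasure (distr (reroute \<pi> J K x) borel snd) A = (\<integral>\<^sup>+q. indicator A (snd q) \<partial>reroute \<pi> J K x)"
      using nn_integral_distr[of snd "reroute \<pi> J K x" borel "indicator A"] by simp
    also have "\<dots> = (\<Sum>j\<in>J. \<integral>\<^sup>+p. ennreal (K j (snd p)) * indicator A (x j) \<partial>\<pi>)"
      by (subst nn_integral_reroute[OF J \<pi> K]) auto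
    also have "\<dots> = (\<Sum>j\<in>J. indicator A (x j) * (1 / of_nat (card J)))"
      by (intro sum.cong refl) (simp add: nn_integral_multc Kint, simp only: mult.commute)
    also have "\<dots> = emeasure (empirical_measure J x) A"
      using A by (subst emeasure_empirical_measure)
        (simp_all add: divide_ennreal_def sum_distrib_right)
    finally show "emeasure (distr (reroute \<pi> J K x) borel snd) A = emeasure (empirical_measure J x) A" .
  qed simp
  have "prob_space (distr (reroute \<pi> J K x) borel fst)"
    unfolding fst_eq by (rule prob_space_distr) simp
  then have "prob_space (reroute \<pi> J K x)"
    by (rule prob_space_distrD[rotated]) simp
  then show ?thesis
    using sets_r fst_eq snd_eq by (simp add: couplings_def)
qed

section \<open>Robust Wasserstein distance to an empirical measure\<close>

lemma product_in_couplings: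
  assumes "prob_space \<mu>" "prob_space \<nu>" "sets \<mu> = sets borel" "sets \<nu> = sets borel"
  shows "\<mu> \<Otimes>\<^sub>M \<nu> \<in> couplings \<mu> \<nu>"
proof -
  interpret \<mu>: prob_space \<mu> by fact
  interpret \<nu>: prob_space \<nu> by fact
  interpret P: pair_prob_space \<mu> \<nu> ..
  have "distr (\<mu> \<Otimes>\<^sub>M \<nu>) borel fst = distr (\<mu> \<Otimes>\<^sub>M \<nu>) \<mu> fst"
    using assms by (intro distr_cong) auto
  moreover have "distr (\<mu> \<Otimes>\<^sub>M \<nu>) borel snd = distr (\<mu> \<Otimes>\<^sub>M \<nu>) \<nu> snd"
    using assms by (intro distr_cong) auto
  moreover have "distr (\<mu> \<Otimes>\<^sub>M \<nu>) \<nu> snd = \<nu>"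
  proof (rule measure_eqI)
    fix A assume "A \<in> sets (distr (\<mu> \<Otimes>\<^sub>M \<nu>) \<nu> snd)"
    then have A: "A \<in> sets \<nu>" by simp
    have "snd -` A \<inter> space (\<mu> \<Otimes>\<^sub>M \<nu>) = space \<mu> \<times> A"
      using sets.sets_into_space[OF A] by (auto simp: space_pair_measure)
    then show "emeasure (distr (\<mu> \<Otimes>\<^sub>M \<nu>) \<nu> snd) A = emeasure \<nu> A"
      using A by (simp add: emeasure_distr \<nu>.emeasure_pair_measure_Times \<mu>.emeasure_space_1)
  qed simp
  moreover have "sets (\<mu> \<Otimes>\<^sub>M \<nu>) = sets (borel \<Otimes>\<^sub>M borel)"
    by (intro sets_pair_measure_cong assms)
  ultimately show ?thesis
    using P.prob_space_axioms \<nu>.distr_pair_fst[of \<mu>] by (simp add: couplings_def)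
qed

abbreviation truncated_dist :: "real \<Rightarrow> 'a::metric_space \<Rightarrow> 'a \<Rightarrow> real" where
  "truncated_dist lam u v \<equiv> min (dist u v) (2 * lam)"

abbreviation transport_cost :: "real \<Rightarrow> ('a::metric_space \<times> 'a) measure \<Rightarrow> real" where
  "transport_cost lam \<pi> \<equiv> (\<integral>p. truncated_dist lam (fst p) (snd p) \<partial>\<pi>)"

lemma
  fixes \<pi> :: "('a::{metric_space, second_countable_topology} \<times> 'a) measure"
  assumes \<pi>: "\<pi> \<in> couplings \<mu> \<nu>" and lam: "lam \<ge> 0"
  shows integrable_truncated_dist: "integrable \<pi> (\<lambda>p. truncated_dist lam (fst p) (snd p))"
    and transport_cost_nonneg: "0 \<le> transport_cost lam \<pi>"
    and transport_cost_le: "transport_cost lam \<pi> \<le> 2 * lam"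
    and robust_wasserstein_le_cost: "robust_wasserstein lam \<mu> \<nu> \<le> transport_cost lam \<pi>"
proof -
  interpret prob_space \<pi> using \<pi> by (simp add: couplings_def)
  have [measurable_cong]: "sets \<pi> = sets (borel \<Otimes>\<^sub>M borel)"
    using \<pi> by (simp add: couplings_def)
  show int: "integrable \<pi> (\<lambda>p. truncated_dist lam (fst p) (snd p))"
    by (rule integrable_const_bound[of _ "2 * lam"]) (use lam in auto)
  show "0 \<le> transport_cost lam \<pi>" using lam by (intro Bochner_Integration.integral_nonneg) auto
  have "transport_cost lam \<pi> \<le> (\<integral>p. 2 * lam \<partial>\<pi>)"
    by (intro integral_mono int) auto
  then show "transport_cost lam \<pi> \<le> 2 * lam" by (simp add: prob_space)
  have "0 \<le> transport_cost lam \<pi>'" for \<pi>' :: "('a \<times> 'a) measure"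
    using lam by (intro Bochner_Integration.integral_nonneg) auto
  then show "robust_wasserstein lam \<mu> \<nu> \<le> transport_cost lam \<pi>"
    unfolding robust_wasserstein_def by (intro cINF_lower \<pi> bdd_belowI2[of _ 0])
qed

lemma robust_wasserstein_bounds:
  fixes \<mu> \<nu> :: "'a::{metric_space, second_countable_topology} measure"
  assumes "prob_space \<mu>" "prob_space \<nu>" "sets \<mu> = sets borel" "sets \<nu> = sets borel" "lam \<ge> 0"
  shows "0 \<le> robust_wasserstein lam \<mu> \<nu>" and "robust_wasserstein lam \<mu> \<nu> \<le> 2 * lam"
proof -
  have p: "\<mu> \<Otimes>\<^sub>M \<nu> \<in> couplings \<mu> \<nu>" by (rule product_in_couplings) fact+
  then show "0 \<le> robust_wasserstein lam \<mu> \<nu>"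
    unfolding robust_wasserstein_def using transport_cost_nonneg assms(5) by (intro cINF_greatest) auto
  show "robust_wasserstein lam \<mu> \<nu> \<le> 2 * lam"
    using robust_wasserstein_le_cost[OF p assms(5)] transport_cost_le[OF p assms(5)] by simp
qed

text \<open>
  The single comparison result between empirical measures from which all estimates on the
  distance follow.  A Markov matrix \<open>P\<close> that carries the uniform distribution on \<open>J\<close> to the one
  on \<open>J'\<close> turns any coupling of \<open>\<mu>\<close> with the first empirical measure into a coupling with the
  second: given the target \<open>v\<close>, draw an index uniformly among those with \<open>y i = v\<close> and move
  according to row \<open>i\<close> of \<open>P\<close>.  The factor \<open>a\<close> is needed besides the additive terms \<open>b\<close> because
  a row may keep only a fraction of its mass in place.
\<close>

lemma robust_wasserstein_empirical_transfer:
  fixes \<mu> :: "'a::{metric_space, second_countable_topology} measure"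
    and x :: "'j \<Rightarrow> 'a" and y :: "'i \<Rightarrow> 'a" and P :: "'i \<Rightarrow> 'j \<Rightarrow> real"
  assumes \<mu>: "prob_space \<mu>" "sets \<mu> = sets borel"
    and J: "finite J" "J \<noteq> {}" and J': "finite J'" "J' \<noteq> {}"
    and lam: "lam \<ge> 0"
    and P0: "\<And>i j. i \<in> J \<Longrightarrow> j \<in> J' \<Longrightarrow> P i j \<ge> 0"
    and row: "\<And>i. i \<in> J \<Longrightarrow> (\<Sum>j\<in>J'. P i j) = 1"
    and col: "\<And>j. j \<in> J' \<Longrightarrow> (\<Sum>i\<in>J. P i j) / real (card J) = 1 / real (card J')"
    and a: "a > 0"
    and cost: "\<And>i u. i \<in> J \<Longrightarrow>
        (\<Sum>j\<in>J'. P i j * truncated_dist lam u (x j)) \<le> a * truncated_dist lam u (y i) + b i"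
  shows "robust_wasserstein lam \<mu> (empirical_measure J' x)
      \<le> a * robust_wasserstein lam \<mu> (empirical_measure J y) + (\<Sum>i\<in>J. b i) / real (card J)"
proof -
  define K where "K j = fibre_mean J y (\<lambda>i. P i j)" for j
  define \<beta> where "\<beta> = (\<Sum>i\<in>J. b i) / real (card J)"
  have [measurable]: "K j \<in> borel_measurable borel" for j
    unfolding K_def by (rule borel_measurable_fibre_mean)
  have K0: "K j v \<ge> 0" if "j \<in> J'" for j v
    unfolding K_def fibre_mean_def by (intro divide_nonneg_nonneg sum_nonneg) (use that P0 in auto)
  have Ksum: "(\<Sum>j\<in>J'. K j v * r j) = fibre_mean J y (\<lambda>i. \<Sum>j\<in>J'. P i j * r j) v" for v r
    unfolding K_def by (rule fibre_mean_sum_mult)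
  have le: "robust_wasserstein lam \<mu> (empirical_measure J' x) \<le> a * transport_cost lam \<pi> + \<beta>"
    if \<pi>: "\<pi> \<in> couplings \<mu> (empirical_measure J y)" for \<pi>
  proof -
    have \<pi>s: "prob_space \<pi>" and \<pi>sets [measurable_cong]: "sets \<pi> = sets (borel \<Otimes>\<^sub>M borel)"
      and \<pi>fst: "distr \<pi> borel fst = \<mu>" and \<pi>snd: "distr \<pi> borel snd = empirical_measure J y"
      using \<pi> by (auto simp: couplings_def)
    interpret prob_space \<pi> by fact
    note AE_J = AE_snd_marginal_empirical[OF J \<pi>sets \<pi>snd]
    note int_emp = integrable_snd_marginal_empirical[OF J \<pi>sets \<pi>snd]
    note lint_emp = integral_snd_marginal_empirical[OF J \<pi>sets \<pi>snd]
    \<comment> \<open>The rows of \<open>P\<close> sum to one, hence so does the kernel, at every sample value.\<close>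
    have K1: "(\<Sum>j\<in>J'. K j v) = 1" if "v \<in> y ` J" for v
    proof -
      have "(\<Sum>j\<in>J'. K j v) = fibre_mean J y (\<lambda>i. \<Sum>j\<in>J'. P i j) v"
        using Ksum[of v "\<lambda>_. 1"] by simp
      also have "\<dots> = fibre_mean J y (\<lambda>i. 1) v"
        unfolding fibre_mean_def using row by simp
      finally show ?thesis using fibre_mean_const[OF J(1) that] by simp
    qed
    \<comment> \<open>The tower property turns the column condition on \<open>P\<close> into the correct second marginal.\<close>
    have Kint: "(\<integral>\<^sup>+p. ennreal (K j (snd p)) \<partial>\<pi>) = 1 / of_nat (card J')" if j: "j \<in> J'" for j
    proof -
      have "(\<integral>\<^sup>+p. ennreal (K j (snd p)) \<partial>\<pi>) = ennreal (\<integral>p. K j (snd p) \<partial>\<pi>)"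
        using K0[OF j] by (intro nn_integral_eq_integral int_emp) auto
      also have "(\<integral>p. K j (snd p) \<partial>\<pi>) = (\<Sum>i\<in>J. P i j) / real (card J)"
        by (subst lint_emp) (auto simp: K_def sum_fibre_mean[OF J(1)])
      also have "\<dots> = 1 / real (card J')" by (rule col[OF j])
      finally show ?thesis using J' divide_ennreal[of 1 "real (card J')"]
        by (simp add: card_gt_0_iff ennreal_of_nat_eq_real_of_nat)
    qed
    let ?\<pi>' = "reroute \<pi> J' K x"
    let ?T = "\<lambda>p. \<Sum>j\<in>J'. K j (snd p) * truncated_dist lam (fst p) (x j)"
    have \<pi>': "?\<pi>' \<in> couplings \<mu> (empirical_measure J' x)"
      unfolding \<pi>fst[symmetric]
      by (rule reroute_in_couplings[OF J'(1) \<pi>s \<pi>sets]) (use K0 K1 Kint AE_J in auto)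
    have T0: "?T p \<ge> 0" for p using K0 lam by (intro sum_nonneg mult_nonneg_nonneg) auto
    have Tle: "AE p in \<pi>. ?T p \<le> a * truncated_dist lam (fst p) (snd p) + fibre_mean J y b (snd p)"
      using AE_J
    proof eventually_elim
      case (elim p)
      have "?T p = fibre_mean J y (\<lambda>i. \<Sum>j\<in>J'. P i j * truncated_dist lam (fst p) (x j)) (snd p)"
        by (rule Ksum)
      also have "\<dots> \<le> fibre_mean J y (\<lambda>i. a * truncated_dist lam (fst p) (snd p) + b i) (snd p)"
        by (rule fibre_mean_mono) (metis cost)
      also have "\<dots> = a * truncated_dist lam (fst p) (snd p) + fibre_mean J y b (snd p)"
        unfolding fibre_mean_add fibre_mean_const[OF J(1) elim] ..
      finally show ?case .
    qed
    have int_d: "integrable \<pi> (\<lambda>p. a * truncated_dist lam (fst p) (snd p))"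
      using integrable_truncated_dist[OF \<pi> lam] by simp
    have int_b: "integrable \<pi> (\<lambda>p. fibre_mean J y b (snd p))"
      by (rule int_emp[OF borel_measurable_fibre_mean])
    note intR = Bochner_Integration.integrable_add[OF int_d int_b]
    have intT: "integrable \<pi> ?T"
    proof (rule Bochner_Integration.integrable_bound[OF intR])
      show "AE p in \<pi>. norm (?T p)
          \<le> norm (a * truncated_dist lam (fst p) (snd p) + fibre_mean J y b (snd p))"
        using Tle
      proof eventually_elim
        case (elim p)
        with T0[of p] show ?case unfolding real_norm_def by linarith
      qed
    qed measurable
    have "ennreal (transport_cost lam ?\<pi>') = (\<integral>\<^sup>+q. ennreal (truncated_dist lam (fst q) (snd q)) \<partial>?\<pi>')"
      using lam
      by (intro nn_integral_eq_integral[symmetric] integrable_truncated_dist[OF \<pi>' lam]) auto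
    also have "\<dots> = (\<Sum>j\<in>J'. \<integral>\<^sup>+p. ennreal (K j (snd p)) * ennreal (truncated_dist lam (fst p) (x j)) \<partial>\<pi>)"
      by (subst nn_integral_reroute[OF J'(1) \<pi>s \<pi>sets]) auto
    also have "\<dots> = (\<integral>\<^sup>+p. (\<Sum>j\<in>J'. ennreal (K j (snd p)) * ennreal (truncated_dist lam (fst p) (x j))) \<partial>\<pi>)"
      by (subst nn_integral_sum) auto
    also have "\<dots> = (\<integral>\<^sup>+p. ennreal (?T p) \<partial>\<pi>)"
      using K0 lam by (intro nn_integral_cong) (simp flip: ennreal_mult)
    also have "\<dots> = ennreal (\<integral>p. ?T p \<partial>\<pi>)"
      by (intro nn_integral_eq_integral intT AE_I2 T0)
    finally have "transport_cost lam ?\<pi>' = (\<integral>p. ?T p \<partial>\<pi>)"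
      by (simp only: ennreal_inj[OF transport_cost_nonneg[OF \<pi>' lam]
            Bochner_Integration.integral_nonneg[OF T0]])
    also have "\<dots> \<le> (\<integral>p. a * truncated_dist lam (fst p) (snd p) + fibre_mean J y b (snd p) \<partial>\<pi>)"
      by (rule integral_mono_AE[OF intT intR Tle])
    also have "\<dots> = a * transport_cost lam \<pi> + \<beta>"
      unfolding Bochner_Integration.integral_add[OF int_d int_b] \<beta>_def
        lint_emp[OF borel_measurable_fibre_mean] sum_fibre_mean[OF J(1)] by simp
    finally show ?thesis
      using robust_wasserstein_le_cost[OF \<pi>' lam] by simp
  qed
  have "couplings \<mu> (empirical_measure J y) \<noteq> {}"
    using product_in_couplings[OF \<mu>(1) prob_space_empirical_measure[OF J] \<mu>(2)] by fastforce
  then have "(robust_wasserstein lam \<mu> (empirical_measure J' x) - \<beta>) / a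
      \<le> robust_wasserstein lam \<mu> (empirical_measure J y)"
    unfolding robust_wasserstein_def[of lam \<mu> "empirical_measure J y"]
    using le a by (intro cINF_greatest) (auto simp: field_simps)
  then show ?thesis using a by (simp add: field_simps \<beta>_def)
qed

lemma truncated_dist_triangle:
  assumes "lam \<ge> 0"
  shows "truncated_dist lam u w \<le> truncated_dist lam u v + truncated_dist lam v w"
  using dist_triangle[of u w v] zero_le_dist[of u v] zero_le_dist[of v w] assms
  by linarith

text \<open>
  Each sample point is sent to its counterpart, that is, \<open>P\<close> is the identity matrix.
\<close>

lemma robust_wasserstein_empirical_lipschitz:
  fixes \<mu> :: "'a::{metric_space, second_countable_topology} measure" and x y :: "'i \<Rightarrow> 'a"
  assumes \<mu>: "prob_space \<mu>" "sets \<mu> = sets borel"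
    and J: "finite J" "J \<noteq> {}" and lam: "lam \<ge> 0"
  shows "\<bar>robust_wasserstein lam \<mu> (empirical_measure J x)
           - robust_wasserstein lam \<mu> (empirical_measure J y)\<bar>
      \<le> (\<Sum>i\<in>J. truncated_dist lam (x i) (y i)) / real (card J)"
proof -
  have *: "robust_wasserstein lam \<mu> (empirical_measure J x)
      \<le> 1 * robust_wasserstein lam \<mu> (empirical_measure J y)
        + (\<Sum>i\<in>J. truncated_dist lam (y i) (x i)) / real (card J)" for x y :: "'i \<Rightarrow> 'a"
    by (rule robust_wasserstein_empirical_transfer[OF \<mu> J J lam, where P = "\<lambda>i j. of_bool (i = j)"])
       (use J truncated_dist_triangle[OF lam] in \<open>simp_all add: of_bool_def if_distrib[of "\<lambda>r. r * _"] cong: if_cong\<close>)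
  show ?thesis
    using *[of x y] *[of y x] by (simp add: dist_commute)
qed

text \<open>
  Let \<open>k\<close>, \<open>z\<close> and \<open>n = k + z\<close> be the sizes of \<open>I\<close>, \<open>Z\<close> and their union.  For the upper bound,
  an inlier keeps the fraction \<open>k / n\<close> of its mass and spreads the rest evenly over the
  outliers.  For the lower bound, each outlier spreads its mass evenly over the inliers; this
  bounds the distance for the inliers alone without a factor, and the factor \<open>k / n \<le> 1\<close> can be
  inserted since distances are nonnegative.  Moved mass costs at most \<open>2 * lam\<close> per unit, because
  the cost is truncated.
\<close>

lemma robust_wasserstein_empirical_outliers:
  fixes \<mu> :: "'a::{metric_space, second_countable_topology} measure" and x :: "'i \<Rightarrow> 'a"
  assumes \<mu>: "prob_space \<mu>" "sets \<mu> = sets borel"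
    and fin: "finite I" "finite Z" "I \<noteq> {}" "I \<inter> Z = {}" and lam: "lam \<ge> 0"
  shows "\<bar>robust_wasserstein lam \<mu> (empirical_measure (I \<union> Z) x)
           - real (card I) / real (card (I \<union> Z)) * robust_wasserstein lam \<mu> (empirical_measure I x)\<bar>
      \<le> 2 * lam * real (card Z) / real (card (I \<union> Z))"
proof -
  let ?S = "I \<union> Z"
  let ?k = "real (card I)" and ?z = "real (card Z)" and ?n = "real (card ?S)"
  have S: "finite ?S" "?S \<noteq> {}" using fin by auto
  have k: "?k > 0" using fin by (simp add: card_gt_0_iff)
  have n_eq: "?n = ?k + ?z" using fin by (simp add: card_Un_disjoint)
  have n: "?n > 0" using k n_eq by simp
  have split: "(\<Sum>j\<in>?S. g j) = (\<Sum>j\<in>I. g j) + (\<Sum>j\<in>Z. g j)" for g :: "'i \<Rightarrow> real"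
    using fin by (simp add: sum.union_disjoint)
  have IZ: "j \<in> Z \<Longrightarrow> j \<notin> I" for j using fin by auto
  have upper: "robust_wasserstein lam \<mu> (empirical_measure ?S x)
      \<le> ?k / ?n * robust_wasserstein lam \<mu> (empirical_measure I x)
        + (\<Sum>i\<in>I. ?z / ?n * (2 * lam)) / ?k"
  proof (rule robust_wasserstein_empirical_transfer[OF \<mu> fin(1,3) S lam,
        where P = "\<lambda>i j. if j \<in> I then (if i = j then ?k / ?n else 0) else 1 / ?n"])
    fix i assume i: "i \<in> I"
    have row: "(\<Sum>j\<in>?S. (if j \<in> I then (if i = j then ?k / ?n else 0) else 1 / ?n) * r j)
        = ?k / ?n * r i + (\<Sum>j\<in>Z. r j) / ?n" for r :: "'i \<Rightarrow> real"
    proof -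
      have "(\<Sum>j\<in>I. (if j \<in> I then (if i = j then ?k / ?n else 0) else 1 / ?n) * r j)
          = (\<Sum>j\<in>I. if i = j then ?k / ?n * r j else 0)"
        by (intro sum.cong) auto
      moreover have "(\<Sum>j\<in>Z. (if j \<in> I then (if i = j then ?k / ?n else 0) else 1 / ?n) * r j)
          = (\<Sum>j\<in>Z. r j / ?n)"
        by (intro sum.cong) (auto dest: IZ)
      ultimately show ?thesis
        unfolding split using i fin by (simp only: sum_divide_distrib) simp
    qed
    show "(\<Sum>j\<in>?S. if j \<in> I then (if i = j then ?k / ?n else 0) else 1 / ?n) = 1"
      using row[of "\<lambda>_. 1"] n by (simp add: n_eq add_divide_distrib[symmetric])
    fix u
    have "(\<Sum>j\<in>Z. truncated_dist lam u (x j)) \<le> (\<Sum>j\<in>Z. 2 * lam)"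
      by (intro sum_mono) simp
    then have "(\<Sum>j\<in>Z. truncated_dist lam u (x j)) / ?n \<le> ?z * (2 * lam) / ?n"
      using n by (intro divide_right_mono) auto
    then show "(\<Sum>j\<in>?S. (if j \<in> I then (if i = j then ?k / ?n else 0) else 1 / ?n) * truncated_dist lam u (x j))
        \<le> ?k / ?n * truncated_dist lam u (x i) + ?z / ?n * (2 * lam)"
      unfolding row by simp
  next
    fix j assume j: "j \<in> ?S"
    show "(\<Sum>i\<in>I. if j \<in> I then (if i = j then ?k / ?n else 0) else 1 / ?n) / ?k = 1 / ?n"
      using j fin(1,3) k by (cases "j \<in> I") simp_all
  qed (use k n in auto)
  have lower: "robust_wasserstein lam \<mu> (empirical_measure I x)
      \<le> 1 * robust_wasserstein lam \<mu> (empirical_measure ?S x)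
        + (\<Sum>i\<in>?S. if i \<in> I then 0 else 2 * lam) / ?n"
  proof (rule robust_wasserstein_empirical_transfer[OF \<mu> S fin(1,3) lam,
        where P = "\<lambda>i j. if i \<in> I then (if i = j then 1 else 0) else 1 / ?k"])
    fix i assume i: "i \<in> ?S"
    show "(\<Sum>j\<in>I. if i \<in> I then (if i = j then 1 else 0) else 1 / ?k) = 1"
      using fin(1,3) k by (cases "i \<in> I") simp_all
    fix u
    show "(\<Sum>j\<in>I. (if i \<in> I then (if i = j then 1 else 0) else 1 / ?k) * truncated_dist lam u (x j))
        \<le> 1 * truncated_dist lam u (x i) + (if i \<in> I then 0 else 2 * lam)"
    proof (cases "i \<in> I")
      case True
      have "(\<Sum>j\<in>I. (if i = j then 1 else 0) * truncated_dist lam u (x j))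
          = (\<Sum>j\<in>I. if i = j then truncated_dist lam u (x j) else 0)"
        by (intro sum.cong) auto
      then show ?thesis using True fin(1) by simp
    next
      case False
      have "(\<Sum>j\<in>I. 1 / ?k * truncated_dist lam u (x j)) \<le> (\<Sum>j\<in>I. 1 / ?k * (2 * lam))"
        by (intro sum_mono mult_left_mono) auto
      also have "\<dots> = 2 * lam" using k by simp
      also have "\<dots> \<le> 1 * truncated_dist lam u (x i) + 2 * lam" using lam by simp
      finally show ?thesis using False by simp
    qed
  next
    fix j assume j: "j \<in> I"
    have "(\<Sum>i\<in>Z. if i \<in> I then (if i = j then 1 else 0) else 1 / ?k) = (\<Sum>i\<in>Z. 1 / ?k)"
      by (intro sum.cong) (auto dest: IZ)
    moreover have "(\<Sum>i\<in>I. if i \<in> I then (if i = j then 1 else 0) else 1 / ?k) = (1::real)"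
      using j fin(1) by simp
    ultimately show "(\<Sum>i\<in>?S. if i \<in> I then (if i = j then 1 else 0) else 1 / ?k) / ?n = 1 / ?k"
      unfolding split using k n by (simp add: n_eq field_simps)
  qed (use k in auto)
  have "(\<Sum>i\<in>Z. if i \<in> I then 0 else 2 * lam) = (\<Sum>i\<in>Z. 2 * lam)"
    by (intro sum.cong) (auto dest: IZ)
  then have "(\<Sum>i\<in>?S. if i \<in> I then 0 else 2 * lam) = ?z * (2 * lam)"
    unfolding split by simp
  then have lower': "robust_wasserstein lam \<mu> (empirical_measure I x)
      \<le> robust_wasserstein lam \<mu> (empirical_measure ?S x) + 2 * lam * ?z / ?n"
    using lower by (simp add: mult_ac)
  have "?k / ?n * robust_wasserstein lam \<mu> (empirical_measure I x)
      \<le> 1 * robust_wasserstein lam \<mu> (empirical_measure I x)"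
    using n_eq n robust_wasserstein_bounds(1)[OF \<mu>(1) prob_space_empirical_measure[OF fin(1,3)] \<mu>(2) _ lam]
    by (intro mult_right_mono) auto
  then show ?thesis
    using lower' upper k by (simp add: abs_le_iff mult_ac)
qed

lemma empirical_measure_cong:
  assumes "\<And>i. i \<in> J \<Longrightarrow> x i = y i"
  shows "empirical_measure J x = empirical_measure J y"
  unfolding empirical_measure_def using assms by (simp cong: sum.cong)

text \<open>
  The infimum defining the distance ranges over an uncountable set, so measurability is obtained
  from continuity: by the Lipschitz estimate the distance is continuous in the sample for the
  product topology, whose Borel sets are those of the product \<open>\<sigma>\<close>-algebra because the index type
  is countable and the space second countable.
\<close>

lemma borel_measurable_robust_wasserstein_empirical:
  fixes \<mu> :: "'a::{metric_space, second_countable_topology} measure" and J :: "'i::countable set"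
  assumes \<mu>: "prob_space \<mu>" "sets \<mu> = sets borel"
    and J: "finite J" "J \<noteq> {}" and lam: "lam \<ge> 0"
  shows "(\<lambda>x. robust_wasserstein lam \<mu> (empirical_measure J x)) \<in> borel_measurable (Pi\<^sub>M J (\<lambda>_. borel))"
proof -
  define F where "F x = robust_wasserstein lam \<mu> (empirical_measure J x)" for x :: "'i \<Rightarrow> 'a"
  have "continuous_on UNIV F"
    unfolding continuous_on_def
  proof
    fix x :: "'i \<Rightarrow> 'a"
    have "((\<lambda>y. (\<Sum>i\<in>J. truncated_dist lam (y i) (x i)) / real (card J)) \<longlongrightarrow>
        (\<Sum>i\<in>J. truncated_dist lam (x i) (x i)) / real (card J)) (at x within UNIV)"
    proof (intro tendsto_intros)
      fix i
      show "((\<lambda>y. y i) \<longlongrightarrow> x i) (at x within UNIV)"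
        by (rule bspec[OF continuous_on_product_coordinates[unfolded continuous_on_def] UNIV_I])
    qed (use J in auto)
    then have "((\<lambda>y. (\<Sum>i\<in>J. truncated_dist lam (y i) (x i)) / real (card J)) \<longlongrightarrow> 0) (at x within UNIV)"
      using lam by simp
    moreover have "\<forall>\<^sub>F y in at x within UNIV. norm (F y - F x)
        \<le> (\<Sum>i\<in>J. truncated_dist lam (y i) (x i)) / real (card J)"
      using robust_wasserstein_empirical_lipschitz[OF \<mu> J lam] by (intro always_eventually) (simp add: F_def)
    ultimately have "((\<lambda>y. F y - F x) \<longlongrightarrow> 0) (at x within UNIV)"
      by (rule Lim_null_comparison[rotated])
    then show "(F \<longlongrightarrow> F x) (at x within UNIV)"
      by (simp add: LIM_zero_iff)
  qed
  then have "F \<in> borel_measurable borel"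
    by (rule borel_measurable_continuous_onI)
  then have F [measurable]: "F \<in> borel_measurable (Pi\<^sub>M UNIV (\<lambda>_. borel))"
    using measurable_cong_sets[OF sets_PiM_equal_borel refl] by blast
  \<comment> \<open>Points of the product over \<open>J\<close> are extended to all indices; the distance does not see the
    extension.\<close>
  have "(\<lambda>x i. if i \<in> J then x i else undefined) \<in> Pi\<^sub>M J (\<lambda>_. borel) \<rightarrow>\<^sub>M Pi\<^sub>M UNIV (\<lambda>_. borel :: 'a measure)"
  proof (rule measurable_abs_UNIV)
    fix i
    show "(\<lambda>x. if i \<in> J then x i else undefined) \<in> Pi\<^sub>M J (\<lambda>_. borel :: 'a measure) \<rightarrow>\<^sub>M borel"
      by (cases "i \<in> J") auto
  qed
  from measurable_compose[OF this F]
  have "(\<lambda>x. F (\<lambda>i. if i \<in> J then x i else undefined)) \<in> borel_measurable (Pi\<^sub>M J (\<lambda>_. borel))" .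
  moreover have "F (\<lambda>i. if i \<in> J then x i else undefined) = F x" for x
    unfolding F_def by (rule arg_cong[OF empirical_measure_cong]) simp
  ultimately show ?thesis
    by (simp add: F_def)
qed

section \<open>Concentration in the outlier-inlier setting\<close>

context outlier_inlier_setting
begin

abbreviation inlier_wasserstein :: "real \<Rightarrow> 'w \<Rightarrow> real" where
  "inlier_wasserstein lam \<omega> \<equiv> robust_wasserstein lam \<mu> (empirical_measure In (\<lambda>i. X i \<omega>))"

lemma finite_index: "finite In" "finite Out"
  using index_partition finite_Un[of In Out] by auto

lemma inlier_measurable: "i \<in> In \<Longrightarrow> X i \<in> measurable M borel"
  using random_variables index_partition by blast

lemma inlier_law: "prob_space \<mu>" "sets \<mu> = sets borel"
proof -
  obtain i where i: "i \<in> In" using inliers_nonempty by auto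
  show "prob_space \<mu>" unfolding inliers_distr[OF i, symmetric]
    by (rule prob_space_distr) (rule inlier_measurable[OF i])
  show "sets \<mu> = sets borel" unfolding inliers_distr[OF i, symmetric] by simp
qed

lemma inliers_joint_law:
  "distr M (Pi\<^sub>M In (\<lambda>_. borel)) (\<lambda>\<omega>. \<lambda>i\<in>In. X i \<omega>) = Pi\<^sub>M In (\<lambda>_. \<mu>)"
proof -
  have "distr M (Pi\<^sub>M In (\<lambda>_. borel)) (\<lambda>\<omega>. \<lambda>i\<in>In. X i \<omega>) = Pi\<^sub>M In (\<lambda>i. distr M borel (X i))"
    using inliers_nonempty inlier_measurable inliers_indep by (simp add: indep_vars_iff_distr_eq_PiM')
  also have "\<dots> = Pi\<^sub>M In (\<lambda>_. \<mu>)"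
    by (intro PiM_cong refl inliers_distr)
  finally show ?thesis .
qed

lemma mean_truncated_sq_dist_eq:
  assumes lam: "lam \<ge> 0"
  shows "mean_truncated_sq_dist M lam In X
    = (\<integral>p. (truncated_dist lam (fst p) (snd p))\<^sup>2 \<partial>(\<mu> \<Otimes>\<^sub>M \<mu>))"
proof -
  interpret \<mu>: prob_space \<mu> by (rule inlier_law)
  have sets_\<mu> [measurable_cong]: "sets \<mu> = sets borel" by (rule inlier_law)
  have "(\<integral>p. min ((dist (X i (fst p)) (X i (snd p)))\<^sup>2) ((2 * lam)\<^sup>2) \<partial>(M \<Otimes>\<^sub>M M))
      = (\<integral>p. (truncated_dist lam (fst p) (snd p))\<^sup>2 \<partial>(\<mu> \<Otimes>\<^sub>M \<mu>))" if i: "i \<in> In" for i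
  proof -
    note [measurable] = inlier_measurable[OF i]
    have "sigma_finite_measure (distr M borel (X i))"
      unfolding inliers_distr[OF i] by unfold_locales
    then have "\<mu> \<Otimes>\<^sub>M \<mu> = distr (M \<Otimes>\<^sub>M M) (borel \<Otimes>\<^sub>M borel) (\<lambda>(\<omega>, \<omega>'). (X i \<omega>, X i \<omega>'))"
      using pair_measure_distr[of "X i" M borel "X i" M borel] inliers_distr[OF i] by simp
    then have "(\<integral>p. (truncated_dist lam (fst p) (snd p))\<^sup>2 \<partial>(\<mu> \<Otimes>\<^sub>M \<mu>))
        = (\<integral>p. (truncated_dist lam (X i (fst p)) (X i (snd p)))\<^sup>2 \<partial>(M \<Otimes>\<^sub>M M))"
      by (simp add: integral_distr case_prod_beta')
    also have "\<dots> = (\<integral>p. min ((dist (X i (fst p)) (X i (snd p)))\<^sup>2) ((2 * lam)\<^sup>2) \<partial>(M \<Otimes>\<^sub>M M))"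
    proof (rule Bochner_Integration.integral_cong[OF refl])
      fix p
      show "(truncated_dist lam (X i (fst p)) (X i (snd p)))\<^sup>2
          = min ((dist (X i (fst p)) (X i (snd p)))\<^sup>2) ((2 * lam)\<^sup>2)"
        using lam abs_le_square_iff[of "dist (X i (fst p)) (X i (snd p))" "2 * lam"]
        by (simp add: min_def)
    qed
    finally show ?thesis ..
  qed
  then show ?thesis
    using finite_index inliers_nonempty by (simp add: mean_truncated_sq_dist_def)
qed

lemma inlier_wasserstein_measurable:
  assumes "lam \<ge> 0"
  shows "inlier_wasserstein lam \<in> borel_measurable M"
proof -
  have "(\<lambda>\<omega>. \<lambda>i\<in>In. X i \<omega>) \<in> M \<rightarrow>\<^sub>M Pi\<^sub>M In (\<lambda>_. borel)"
    by (rule measurable_restrict) (rule inlier_measurable)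
  from measurable_compose[OF this borel_measurable_robust_wasserstein_empirical[OF inlier_law
        finite_index(1) inliers_nonempty assms]]
  show ?thesis
    by (simp add: empirical_measure_cong[of In "\<lambda>i\<in>In. X i _" "\<lambda>i. X i _"])
qed

text \<open>
  Changing one of the \<open>k\<close> inliers from \<open>a\<close> to \<open>b\<close> moves the distance by at most
  \<open>min (dist a b) (2 * lam) / k\<close>.  Hence the increments are bounded by \<open>2 * lam / k\<close>, and the sum
  of their mean squares is the mean truncated squared distance divided by \<open>k\<close>.
\<close>

lemma inlier_wasserstein_concentration:
  assumes lam: "lam > 0" and t: "t > 0"
  shows "prob {\<omega> \<in> space M. \<bar>inlier_wasserstein lam \<omega> - expectation (inlier_wasserstein lam)\<bar>
      \<ge> sqrt (2 * (mean_truncated_sq_dist M lam In X / real (card In)) * t) + 2 * lam / real (card In) * t}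
    \<le> 2 * exp (- t)"
proof -
  let ?N = "real (card In)"
  have N: "?N > 0" using finite_index inliers_nonempty by (simp add: card_gt_0_iff)
  define f where "f x = robust_wasserstein lam \<mu> (empirical_measure In x)" for x
  define c where "c a b = truncated_dist lam a b / ?N" for a b :: 'a
  interpret \<mu>: prob_space \<mu> by (rule inlier_law)
  interpret PP: product_prob_space "\<lambda>_. \<mu>" In by unfold_locales
  have sets_\<mu> [measurable_cong]: "sets \<mu> = sets borel" by (rule inlier_law)
  have sets_P: "sets (Pi\<^sub>M In (\<lambda>_. \<mu>)) = sets (Pi\<^sub>M In (\<lambda>_. borel))"
    by (intro sets_PiM_cong refl sets_\<mu>)
  have f [measurable]: "f \<in> borel_measurable (Pi\<^sub>M In (\<lambda>_. borel))"
    unfolding f_def using lam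
    by (intro borel_measurable_robust_wasserstein_empirical inlier_law finite_index inliers_nonempty) simp
  then have f' [measurable]: "f \<in> borel_measurable (Pi\<^sub>M In (\<lambda>_. \<mu>))"
    using measurable_cong_sets[OF sets_P refl] by blast
  have R [measurable]: "(\<lambda>\<omega>. \<lambda>i\<in>In. X i \<omega>) \<in> M \<rightarrow>\<^sub>M Pi\<^sub>M In (\<lambda>_. borel)"
    by (rule measurable_restrict) (rule inlier_measurable)
  have f_eq: "f (\<lambda>i\<in>In. X i \<omega>) = inlier_wasserstein lam \<omega>" for \<omega>
    unfolding f_def by (rule arg_cong[OF empirical_measure_cong]) simp
  have E_eq: "(\<integral>x. f x \<partial>Pi\<^sub>M In (\<lambda>_. \<mu>)) = expectation (inlier_wasserstein lam)"
    unfolding inliers_joint_law[symmetric] by (simp add: integral_distr f_eq)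
  have V_eq: "(\<Sum>i\<in>In. \<integral>p. (c (fst p) (snd p))\<^sup>2 \<partial>(\<mu> \<Otimes>\<^sub>M \<mu>))
      = mean_truncated_sq_dist M lam In X / ?N"
    using lam N by (simp add: c_def power_divide mean_truncated_sq_dist_eq power2_eq_square)
  have tail: "measure (Pi\<^sub>M In (\<lambda>_. \<mu>)) {x \<in> space (Pi\<^sub>M In (\<lambda>_. \<mu>)).
      \<bar>f x - (\<integral>y. f y \<partial>Pi\<^sub>M In (\<lambda>_. \<mu>))\<bar>
        \<ge> sqrt (2 * (\<Sum>i\<in>In. \<integral>p. (c (fst p) (snd p))\<^sup>2 \<partial>(\<mu> \<Otimes>\<^sub>M \<mu>)) * t) + 2 * lam / ?N * t}
    \<le> 2 * exp (- t)"
  proof (rule PP.bounded_differences_concentration[OF finite_index(1) f', where K = "2 * lam"])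
    fix x
    show "\<bar>f x\<bar> \<le> 2 * lam"
      using robust_wasserstein_bounds[OF inlier_law(1)
          prob_space_empirical_measure[OF finite_index(1) inliers_nonempty] inlier_law(2),
          where lam = lam] lam
      by (simp add: f_def)
  next
    fix x :: "nat \<Rightarrow> 'a" and i a assume i: "i \<in> In"
    have "(\<Sum>j\<in>In. truncated_dist lam (x j) ((x(i := a)) j)) = truncated_dist lam (x i) a"
      using i lam finite_index by (subst sum.remove[OF _ i]) (auto intro!: sum.neutral)
    then show "\<bar>f x - f (x(i := a))\<bar> \<le> c (x i) a"
      using robust_wasserstein_empirical_lipschitz[OF inlier_law finite_index(1) inliers_nonempty,
          where lam = lam and x = x and y = "x(i := a)"] lam
      unfolding f_def c_def by (simp del: fun_upd_apply)
  next
    fix a b :: 'a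
    show "c a b \<le> 2 * lam / ?N"
      using N by (simp add: c_def divide_right_mono)
  qed (use lam N t in \<open>simp_all add: c_def\<close>)
  let ?B = "\<lambda>y. \<bar>y - expectation (inlier_wasserstein lam)\<bar>
      \<ge> sqrt (2 * (mean_truncated_sq_dist M lam In X / ?N) * t) + 2 * lam / ?N * t"
  have "measure (Pi\<^sub>M In (\<lambda>_. \<mu>)) {x \<in> space (Pi\<^sub>M In (\<lambda>_. \<mu>)). ?B (f x)}
      = prob ((\<lambda>\<omega>. \<lambda>i\<in>In. X i \<omega>) -` {x \<in> space (Pi\<^sub>M In (\<lambda>_. borel)). ?B (f x)} \<inter> space M)"
    unfolding inliers_joint_law[symmetric] by (subst measure_distr[OF R]) auto
  also have "(\<lambda>\<omega>. \<lambda>i\<in>In. X i \<omega>) -` {x \<in> space (Pi\<^sub>M In (\<lambda>_. borel)). ?B (f x)} \<inter> space M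
      = {\<omega> \<in> space M. ?B (inlier_wasserstein lam \<omega>)}"
    using measurable_space[OF R] by (auto simp: f_eq)
  finally show ?thesis
    using tail by (simp only: V_eq E_eq)
qed

end

theorem theorem3p9:
  fixes M :: "'w measure" and n :: nat and In Out :: "nat set"
    and X :: "nat \<Rightarrow> 'w \<Rightarrow> 'a::polish_space" and \<mu> :: "'a measure"
    and lam \<sigma> :: real
  assumes "outlier_inlier_setting M n In Out X \<mu>"
    and "lam > 0"
    and "\<sigma> \<ge> 0"
    and "\<sigma>\<^sup>2 = mean_truncated_sq_dist M lam In X"
  shows
    "(Out = {} \<longrightarrow> (\<forall>t>0.
        measure M {\<omega> \<in> space M.
          \<bar>robust_wasserstein lam \<mu> (empirical_measure In (\<lambda>i. X i \<omega>))
            - (LINT \<omega>'|M. robust_wasserstein lam \<mu> (empirical_measure In (\<lambda>i. X i \<omega>')))\<bar>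
          > \<sigma> * sqrt (2 * t / real (card In)) + 4 * lam * t / real (card In)}
        \<le> 2 * exp (- t)))
     \<and> (Out \<noteq> {} \<longrightarrow> (\<forall>t>0.
        measure M {\<omega> \<in> space M.
          \<bar>robust_wasserstein lam \<mu> (empirical_measure {1..n} (\<lambda>i. X i \<omega>))
            - real (card In) / real n *
              (LINT \<omega>'|M. robust_wasserstein lam \<mu> (empirical_measure In (\<lambda>i. X i \<omega>')))\<bar>
          > \<sigma> * sqrt (real (card In) / real n) * sqrt (2 * t / real n)
            + 4 * lam * t / real n + 2 * lam * real (card Out) / real n}
        \<le> 2 * exp (- t)))"
proof -
  interpret outlier_inlier_setting M n In Out X \<mu> by fact
  let ?k = "real (card In)"
  define W where "W = inlier_wasserstein lam"
  define m where "m = expectation W"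
  have k: "?k > 0" using finite_index inliers_nonempty by (simp add: card_gt_0_iff)
  have W [measurable]: "W \<in> borel_measurable M"
    unfolding W_def using assms(2) by (intro inlier_wasserstein_measurable) simp
  have main: "prob {\<omega> \<in> space M. \<bar>W \<omega> - m\<bar> > \<sigma> * sqrt (2 * t / ?k) + 4 * lam * t / ?k} \<le> 2 * exp (- t)"
    if t: "t > 0" for t
  proof -
    have "sqrt (2 * (\<sigma>\<^sup>2 / ?k) * t) = sqrt (\<sigma>\<^sup>2 * (2 * t / ?k))"
      by (simp add: mult_ac)
    also have "\<dots> = \<sigma> * sqrt (2 * t / ?k)"
      unfolding real_sqrt_mult using assms(3) by simp
    finally have s: "sqrt (2 * (\<sigma>\<^sup>2 / ?k) * t) = \<sigma> * sqrt (2 * t / ?k)" .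
    have l: "2 * lam / ?k * t \<le> 4 * lam * t / ?k"
      using assms(2) t k by (simp add: field_simps)
    have "prob {\<omega> \<in> space M. \<bar>W \<omega> - m\<bar> > \<sigma> * sqrt (2 * t / ?k) + 4 * lam * t / ?k}
        \<le> prob {\<omega> \<in> space M. \<bar>W \<omega> - m\<bar> \<ge> sqrt (2 * (\<sigma>\<^sup>2 / ?k) * t) + 2 * lam / ?k * t}"
      by (rule finite_measure_mono) (use l s in auto)
    also have "\<dots> \<le> 2 * exp (- t)"
      using inlier_wasserstein_concentration[OF assms(2) t] assms(4) by (simp only: W_def m_def)
    finally show ?thesis .
  qed
  have all: "measure M {\<omega> \<in> space M.
      \<bar>robust_wasserstein lam \<mu> (empirical_measure {1..n} (\<lambda>i. X i \<omega>)) - ?k / real n * m\<bar>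
          > \<sigma> * sqrt (?k / real n) * sqrt (2 * t / real n)
            + 4 * lam * t / real n + 2 * lam * real (card Out) / real n} \<le> 2 * exp (- t)"
    if t: "t > 0" for t
  proof -
    have card_n: "card (In \<union> Out) = n" using index_partition by simp
    have n: "real n > 0"
      using card_n finite_index inliers_nonempty card_gt_0_iff[of "In \<union> Out"] by simp
    have cmp: "\<bar>robust_wasserstein lam \<mu> (empirical_measure {1..n} (\<lambda>i. X i \<omega>)) - ?k / real n * W \<omega>\<bar>
        \<le> 2 * lam * real (card Out) / real n" for \<omega>
      using robust_wasserstein_empirical_outliers[OF inlier_law finite_index inliers_nonempty
          index_partition(2), of lam "\<lambda>i. X i \<omega>"] assms(2)
      by (simp only: index_partition(1) card_atLeastAtMost W_def) simp
    have "?k / real n * (\<sigma> * sqrt (2 * t / ?k)) = \<sigma> * sqrt ((?k / real n)\<^sup>2 * (2 * t / ?k))"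
      unfolding real_sqrt_mult using k n by simp
    also have "(?k / real n)\<^sup>2 * (2 * t / ?k) = ?k / real n * (2 * t / real n)"
      using k n by (simp add: field_simps power2_eq_square)
    finally have s: "?k / real n * (\<sigma> * sqrt (2 * t / ?k)) = \<sigma> * sqrt (?k / real n) * sqrt (2 * t / real n)"
      by (simp only: real_sqrt_mult mult.assoc)
    have scale: "?k / real n * (\<sigma> * sqrt (2 * t / ?k) + 4 * lam * t / ?k)
        = \<sigma> * sqrt (?k / real n) * sqrt (2 * t / real n) + 4 * lam * t / real n"
      unfolding distrib_left s using k by simp
    have gap: "\<bar>w - c\<bar> > r" if "\<bar>a - c\<bar> > r + e" "\<bar>a - w\<bar> \<le> e" for a c e r w :: real
      using that by linarith
    have "\<bar>W \<omega> - m\<bar> > \<sigma> * sqrt (2 * t / ?k) + 4 * lam * t / ?k"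
      if *: "\<bar>robust_wasserstein lam \<mu> (empirical_measure {1..n} (\<lambda>i. X i \<omega>)) - ?k / real n * m\<bar>
          > \<sigma> * sqrt (?k / real n) * sqrt (2 * t / real n)
            + 4 * lam * t / real n + 2 * lam * real (card Out) / real n" for \<omega>
    proof -
      have "\<bar>?k / real n * W \<omega> - ?k / real n * m\<bar>
          > ?k / real n * (\<sigma> * sqrt (2 * t / ?k) + 4 * lam * t / ?k)"
        unfolding scale by (rule gap[OF * cmp])
      also have "\<bar>?k / real n * W \<omega> - ?k / real n * m\<bar> = ?k / real n * \<bar>W \<omega> - m\<bar>"
        unfolding right_diff_distrib[symmetric] abs_mult using k n by simp
      finally show ?thesis
        using k n by (simp only: mult_less_cancel_left_pos divide_pos_pos)
    qed
    then have "measure M {\<omega> \<in> space M.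
      \<bar>robust_wasserstein lam \<mu> (empirical_measure {1..n} (\<lambda>i. X i \<omega>)) - ?k / real n * m\<bar>
          > \<sigma> * sqrt (?k / real n) * sqrt (2 * t / real n)
            + 4 * lam * t / real n + 2 * lam * real (card Out) / real n}
        \<le> prob {\<omega> \<in> space M. \<bar>W \<omega> - m\<bar> > \<sigma> * sqrt (2 * t / ?k) + 4 * lam * t / ?k}"
      by (intro finite_measure_mono) auto
    also have "\<dots> \<le> 2 * exp (- t)" by (rule main[OF t])
    finally show ?thesis .
  qed
  show ?thesis
    using main all unfolding W_def m_def by blast
qed

end
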